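(* Let $\beta\geq\gamma\geq 0$, and let $K$ be an arbitrary measurable subset of $X$ with $\mu(K)=k\in(0,1]$. Then for every non-negative $\phi\in L^p(X,\mu)$ such that $\int_X \phi\, d\mu = f$ and $\int_X \phi^p\, d\mu = F$ the following inequality holds: \[ F\geq \left[ 1-\frac{1}{(1+\gamma)^{p-1}} \right] \int_K \phi^p \, d\mu + \frac{(p-1)\beta}{(\beta+1)^p} \int_X (M_{\mathcal{T}}\phi)^p \, d\mu - \frac{(p-1)\gamma}{(\beta+1)^p} \int_K (M_{\mathcal{T}}\phi)^p \, d\mu + \frac{f^p}{(\beta+1)^{p-1}}. \qquad (\ast) \] Moreover $(\ast)$ is sharp in the following sense: for each $k\in(0,1]$ there exist $\beta,\gamma\geq 0$ with $\beta\geq\gamma$, a sequence $(K_n)_{n\in\mathbb N}$ of measurable subsets of $X$ with $\lim_n \mu(K_n)=k$, and a sequence $(\phi_n)_{n\in\mathbb N}$ of non-negative functions in $L^p(X,\mu)$ with $\int_X \phi_n\, d\mu = f$ and $\int_X \phi_n^p\, d\mu = F$ for all $n$, such that the difference between the two sides of $(\ast)$, written with $\phi=\phi_n$ and $K=K_n$, tends to $0$ as $n\to\infty$ (i.e. equality holds in $(\ast)$ in the limit).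
   Context: Let $(X,\mu)$ be a non-atomic probability space and let $\mathcal T$ be a tree on $X$, i.e. a family of measurable subsets of $X$ such that: $X\in\mathcal T$ and $\mu(I)>0$ for all $I\in\mathcal T$; every $I\in\mathcal T$ has a finite or countable family $C(I)\subseteq\mathcal T$ of at least two pairwise disjoint subsets of $I$ whose union is $I$; $\mathcal T=\bigcup_{m\geq0}\mathcal T_{(m)}$ with $\mathcal T_{(0)}=\{X\}$, $\mathcal T_{(m+1)}=\bigcup_{I\in\mathcal T_{(m)}}C(I)$; $\lim_{m\to\infty}\sup_{I\in\mathcal T_{(m)}}\mu(I)=0$; and $\mathcal T$ differentiates $L^1(X,\mu)$. The dyadic maximal operator is $M_{\mathcal T}\phi(x)=\sup\{\frac{1}{\mu(I)}\int_I|\phi|\,d\mu : x\in I\in\mathcal T\}$. Fix $p>1$ and $f,F$ with $0<f^p\leq F$. *)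

theory Defs
  imports "HOL-Probability.Probability"
begin

definition nonatomic :: "'a measure \<Rightarrow> bool" where
  "nonatomic M \<longleftrightarrow> (\<forall>A\<in>sets M. 0 < measure M A \<longrightarrow>
      (\<exists>B\<in>sets M. B \<subseteq> A \<and> 0 < measure M B \<and> measure M B < measure M A))"

primrec tree_level :: "'a measure \<Rightarrow> ('a set \<Rightarrow> 'a set set) \<Rightarrow> nat \<Rightarrow> 'a set set" where
  "tree_level M C 0 = {space M}"
| "tree_level M C (Suc m) = \<Union> (C ` tree_level M C m)"

definition tree_avg :: "'a measure \<Rightarrow> 'a set \<Rightarrow> ('a \<Rightarrow> real) \<Rightarrow> real" where
  "tree_avg M I \<phi> = (LINT y:I|M. \<bar>\<phi> y\<bar>) / measure M I"

definition differentiates_L1 :: "'a measure \<Rightarrow> 'a set set \<Rightarrow> bool" where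
  "differentiates_L1 M T \<longleftrightarrow> (\<forall>\<phi>. integrable M \<phi> \<longrightarrow>
     (AE x in M. \<forall>\<epsilon>>0. \<exists>\<delta>>0. \<forall>I\<in>T. x \<in> I \<and> measure M I < \<delta> \<longrightarrow>
        \<bar>(LINT y:I|M. \<phi> y) / measure M I - \<phi> x\<bar> < \<epsilon>))"

definition is_tree :: "'a measure \<Rightarrow> 'a set set \<Rightarrow> ('a set \<Rightarrow> 'a set set) \<Rightarrow> bool" where
  "is_tree M T C \<longleftrightarrow>
     T \<subseteq> sets M \<and> space M \<in> T \<and> (\<forall>I\<in>T. 0 < measure M I) \<and>
     (\<forall>I\<in>T. C I \<subseteq> T \<and> countable (C I) \<and> (\<exists>A\<in>C I. \<exists>B\<in>C I. A \<noteq> B) \<and>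
             disjoint (C I) \<and> (\<forall>J\<in>C I. J \<subseteq> I) \<and> \<Union> (C I) = I) \<and>
     T = (\<Union>m. tree_level M C m) \<and>
     (\<lambda>m. Sup (measure M ` tree_level M C m)) \<longlonglongrightarrow> 0 \<and>
     differentiates_L1 M T"

definition maxop :: "'a measure \<Rightarrow> 'a set set \<Rightarrow> ('a \<Rightarrow> real) \<Rightarrow> 'a \<Rightarrow> real" where
  "maxop M T \<phi> x = enn2real (SUP I\<in>{I\<in>T. x \<in> I}. ennreal (tree_avg M I \<phi>))"

end

theory Submission
  imports Defs
begin

text \<open>
  For the inequality, let \<open>m\<close> be the maximal function over a finite subfamily of the tree. Adding
  the tree sets one at a time, smallest last, shows
  \<open>f\<^sup>p \<le> \<integral> p \<phi> m\<^bsup>p-1\<^esup> - (p - 1) m\<^sup>p\<close>. Young's inequality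
  \<open>p a b\<^bsup>p-1\<^esup> \<le> s\<^bsup>p-1\<^esup> a\<^sup>p + (p - 1) b\<^sup>p / s\<close>, with
  \<open>s = (1 + \<beta>) / (1 + \<gamma>)\<close> on \<open>K\<close> and \<open>s = 1 + \<beta>\<close> elsewhere, bounds the right-hand side, and one
  exhausts the tree by finite families.

  For sharpness \<open>\<gamma> = 0\<close> suffices, so that \<open>K\<close> plays no role. Choose a decreasing sequence of
  unions of tree sets, each occupying the proportion \<open>\<theta>\<close> of every maximal tree set of
  its predecessor, and let \<open>\<phi>\<close> grow geometrically along the differences. Then
  \<open>\<phi> \<le> c M \<phi>\<close> with a constant \<open>c\<close> determined by \<open>\<theta>\<close>, \<open>f\<close> and \<open>F\<close>. As \<open>\<theta>\<close> tends to 1, a limit point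
  \<open>l\<close> of \<open>c\<close> satisfies \<open>l\<^sup>p = (F / f\<^sup>p) (1 - p (1 - l))\<close>, and this is equality for
  \<open>\<beta> = 1 / l - 1\<close>.
\<close>

subsection \<open>Real inequalities\<close>

text \<open>Young's inequality for the conjugate exponents \<open>p\<close> and
  \<open>p / (p - 1)\<close>, applied to \<open>a\<close> and \<open>b powr (p - 1)\<close> and
  multiplied by \<open>p\<close>. Equivalently, the graph of \<open>t powr p\<close> lies above its
  tangent at \<open>b\<close>.\<close>

lemma young_powr:
  fixes a b p :: real
  assumes "p > 1" "0 \<le> a" "0 \<le> b"
  shows "p * a * b powr (p - 1) \<le> a powr p + (p - 1) * b powr p"
proof -
  have "1 / p + 1 / (p / (p - 1)) = 1" using assms by (simp add: field_simps)
  then have "a * b powr (p - 1) \<le> a powr p / p + (b powr (p - 1)) powr (p / (p - 1)) / (p / (p - 1))"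
    using assms by (intro Youngs_inequality) auto
  also have "(b powr (p - 1)) powr (p / (p - 1)) = b powr p"
    using assms by (simp add: powr_powr)
  finally have "p * (a * b powr (p - 1)) \<le> p * (a powr p / p + b powr p / (p / (p - 1)))"
    using assms by (intro mult_left_mono) auto
  also have "\<dots> = a powr p + (p - 1) * b powr p" using assms by (simp add: field_simps)
  finally show ?thesis by (simp add: mult.assoc)
qed

text \<open>Rescaling \<open>a\<close> by \<open>u\<close> and \<open>b\<close> by \<open>v\<close>
  with \<open>u * v powr (p - 1) = 1\<close> keeps the left side and shifts weight between the two
  terms on the right.\<close>

lemma young_powr_weighted:
  fixes a b p s :: real
  assumes "p > 1" "0 \<le> a" "0 \<le> b" "s > 0"
  shows "p * a * b powr (p - 1) \<le> s powr (p - 1) * a powr p + (p - 1) / s * b powr p"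
proof -
  define u where "u = s powr ((p - 1) / p)"
  define v where "v = s powr (- (1 / p))"
  have u: "u > 0" and v: "v > 0" using assms by (auto simp: u_def v_def)
  have uv: "u * v powr (p - 1) = 1"
    using assms by (simp add: u_def v_def powr_powr powr_add [symmetric] field_simps)
  have up: "u powr p = s powr (p - 1)" using assms by (simp add: u_def powr_powr)
  have vp: "v powr p = 1 / s"
    unfolding v_def powr_powr using assms by (simp add: powr_minus_divide)
  have "p * a * b powr (p - 1) = p * a * b powr (p - 1) * (u * v powr (p - 1))"
    by (simp only: uv mult_1_right)
  also have "\<dots> = p * (a * u) * (b * v) powr (p - 1)"
    using assms u v by (simp add: powr_mult)
  also have "\<dots> \<le> (a * u) powr p + (p - 1) * (b * v) powr p"
    using assms u v by (intro young_powr) auto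
  also have "\<dots> = s powr (p - 1) * a powr p + (p - 1) / s * b powr p"
    using assms u v by (simp add: powr_mult up vp)
  finally show ?thesis .
qed

text \<open>\<open>r\<close> is the growth ratio and \<open>c\<close> the quotient \<open>\<phi> / M \<phi>\<close> of the extremal functions below;
  the last two inequalities pinch \<open>c\<close> as \<open>\<theta>\<close> tends to 1.\<close>

lemma ratio_exists:
  fixes p \<theta> Q :: real
  assumes p: "p > 1" and \<theta>: "0 < \<theta>" "\<theta> < 1" and Q: "Q \<ge> 1"
  obtains r c where "r \<ge> 1" "\<theta> * r powr p < 1" "0 < c" "c \<le> 1" "c * (1 - \<theta>) = 1 - \<theta> * r"
    "Q * (1 - \<theta> * r powr p) = c powr p * (1 - \<theta>)"
    "c powr p \<le> Q * (1 - p * (1 - c))" "Q * (1 - p * (1 - c) / \<theta>) \<le> c powr p"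
proof -
  \<comment> \<open>At the ratio \<open>R\<close> the geometric series with quotient
    \<open>\<theta> * r powr p\<close>, which later gives the integral of
    \<open>\<phi> powr p\<close>, stops converging. This is the right end of the interval searched
    for \<open>r\<close>.\<close>
  define R where "R = \<theta> powr (- (1 / p))"
  have R1: "R \<ge> 1" using p \<theta> by (simp add: R_def powr_minus_divide powr_le_one_le powr_le1)
  have Rp: "R powr p = 1 / \<theta>" unfolding R_def powr_powr using p \<theta> by (simp add: powr_minus_divide)
  have "\<theta> * R = \<theta> powr (1 - 1 / p)"
    using \<theta> by (simp add: R_def powr_diff powr_minus_divide)
  also have "\<dots> < 1 powr (1 - 1 / p)" using p \<theta> by (intro powr_less_mono2) auto
  finally have tR: "\<theta> * R < 1" by simp
  have pos: "0 < (1 - \<theta> * r) / (1 - \<theta>)" if "r \<le> R" for r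
  proof -
    have "\<theta> * r \<le> \<theta> * R" using that \<theta> by simp
    then have "\<theta> * r < 1" using tR by linarith
    then show ?thesis using \<theta> by simp
  qed
  \<comment> \<open>A zero of \<open>g\<close> is the required relation between \<open>r\<close> and
    \<open>c\<close>, with \<open>c\<close> written out through \<open>r\<close>. At
    \<open>r = 1\<close> the value is \<open>(Q - 1) * (1 - \<theta>)\<close>; at \<open>R\<close>
    the first term vanishes.\<close>
  define g where "g r = Q * (1 - \<theta> * r powr p) - ((1 - \<theta> * r) / (1 - \<theta>)) powr p * (1 - \<theta>)" for r
  have "\<exists>r\<ge>1. r \<le> R \<and> g r = 0"
  proof (rule IVT2')
    show "g R \<le> 0" using \<theta> Rp by (simp add: g_def)
    show "0 \<le> g 1" using \<theta> Q by (simp add: g_def)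
    show "continuous_on {1..R} g" unfolding g_def
      using pos \<theta> by (intro continuous_intros) (auto simp: less_le)
  qed (rule R1)
  then obtain r where r: "1 \<le> r" "r \<le> R" "g r = 0" by blast
  define c where "c = (1 - \<theta> * r) / (1 - \<theta>)"
  have c: "c > 0" using pos r by (simp add: c_def)
  have c1: "c * (1 - \<theta>) = 1 - \<theta> * r" using \<theta> by (simp add: c_def)
  have "\<theta> \<le> \<theta> * r" using \<theta> r by simp
  then have cle: "c \<le> 1" using \<theta> by (simp add: c_def)
  have eq: "Q * (1 - \<theta> * r powr p) = c powr p * (1 - \<theta>)" using r by (simp add: g_def c_def)
  then have "Q * (1 - \<theta> * r powr p) > 0" using c \<theta> by simp
  then have lt: "\<theta> * r powr p < 1" using Q by (simp add: zero_less_mult_iff)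
  have tr: "\<theta> * (r - 1) = (1 - \<theta>) * (1 - c)" using c1 by (simp add: algebra_simps)
  \<comment> \<open>The tangent of \<open>t powr p\<close> at 1 gives Bernoulli's inequality and
    with it the upper bound for \<open>c powr p\<close>.\<close>
  have "p * r \<le> r powr p + (p - 1)" using young_powr [OF p, of r 1] r by simp
  then have "1 + p * (r - 1) \<le> r powr p" by (simp add: algebra_simps)
  then have "\<theta> * (1 + p * (r - 1)) \<le> \<theta> * r powr p" using \<theta> by simp
  then have "1 - \<theta> * r powr p \<le> 1 - \<theta> - p * (\<theta> * (r - 1))" by (simp add: algebra_simps)
  also have "\<dots> = (1 - \<theta>) * (1 - p * (1 - c))" unfolding tr by (simp add: algebra_simps)
  finally have "Q * (1 - \<theta> * r powr p) \<le> Q * ((1 - \<theta>) * (1 - p * (1 - c)))" using Q by simp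
  then have "c powr p * (1 - \<theta>) \<le> Q * (1 - p * (1 - c)) * (1 - \<theta>)" unfolding eq by (simp add: ac_simps)
  then have b1: "c powr p \<le> Q * (1 - p * (1 - c))" using \<theta> by simp
  \<comment> \<open>The lower bound uses the tangent at \<open>r\<close> instead. Its slope contains
    \<open>r powr (p - 1)\<close>, which is at most \<open>1 / \<theta>\<close>; hence the division
    by \<open>\<theta>\<close> in the last bound.\<close>
  have "p * r powr (p - 1) \<le> 1 + (p - 1) * r powr p" using young_powr [OF p, of 1 r] r by simp
  moreover have "r powr p = r * r powr (p - 1)" using r by (simp add: powr_mult_base)
  ultimately have "r powr p - 1 \<le> p * (r - 1) * r powr (p - 1)" by (simp add: algebra_simps)
  also have "\<dots> \<le> p * (r - 1) * (1 / \<theta>)"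
  proof (rule mult_left_mono)
    have "r powr (p - 1) \<le> r powr p" using r by (intro powr_mono) auto
    also have "\<dots> \<le> 1 / \<theta>" using lt \<theta> by (simp add: field_simps)
    finally show "r powr (p - 1) \<le> 1 / \<theta>" .
  qed (use p r in auto)
  finally have "\<theta> * (r powr p - 1) \<le> \<theta> * (p * (r - 1) * (1 / \<theta>))"
    using \<theta> by (intro mult_left_mono) auto
  then have "\<theta> * (r powr p - 1) \<le> p * (\<theta> * (r - 1)) / \<theta>" using \<theta> by simp
  then have "(1 - \<theta>) * (1 - p * (1 - c) / \<theta>) \<le> 1 - \<theta> * r powr p"
    unfolding tr by (simp add: algebra_simps)
  then have "Q * ((1 - \<theta>) * (1 - p * (1 - c) / \<theta>)) \<le> Q * (1 - \<theta> * r powr p)" using Q by simp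
  then have "Q * (1 - p * (1 - c) / \<theta>) * (1 - \<theta>) \<le> c powr p * (1 - \<theta>)" unfolding eq by (simp add: ac_simps)
  then have b2: "Q * (1 - p * (1 - c) / \<theta>) \<le> c powr p" using \<theta> by simp
  show ?thesis using that [OF r(1) lt c cle c1 eq b1 b2] .
qed

subsection \<open>Combinatorics of the tree\<close>

locale tree_space = prob_space M for M :: "'a measure" +
  fixes T :: "'a set set" and C :: "'a set \<Rightarrow> 'a set set"
  assumes tree: "is_tree M T C"
begin

lemma tree_sets: "I \<in> T \<Longrightarrow> I \<in> sets M"
  using tree by (auto simp: is_tree_def)

lemma space_in_tree: "space M \<in> T"
  using tree by (auto simp: is_tree_def)

lemma tree_pos: "I \<in> T \<Longrightarrow> 0 < measure M I"
  using tree by (auto simp: is_tree_def)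

lemma tree_levels: "T = (\<Union>m. tree_level M C m)"
  using tree by (auto simp: is_tree_def)

lemma level_in_tree: "I \<in> tree_level M C m \<Longrightarrow> I \<in> T"
  using tree_levels by auto

lemma children:
  assumes "I \<in> T"
  shows "C I \<subseteq> T" "countable (C I)" "disjoint (C I)" "\<And>J. J \<in> C I \<Longrightarrow> J \<subseteq> I" "\<Union> (C I) = I"
  using tree assms by (auto simp: is_tree_def)

lemma countable_level: "countable (tree_level M C m)"
  by (induction m) (auto intro: children level_in_tree)

lemma countable_tree: "countable T"
  unfolding tree_levels by (simp add: countable_level)

lemma level_cover: "\<Union> (tree_level M C m) = space M"
proof (induction m)
  case (Suc m)
  have "\<Union> (tree_level M C (Suc m)) = (\<Union>I\<in>tree_level M C m. \<Union> (C I))" by auto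
  also have "\<dots> = \<Union> (tree_level M C m)" by (simp add: children level_in_tree)
  finally show ?case using Suc by simp
qed simp

text \<open>If two sets of a level meet, so do their parents; by induction the parents coincide, and
  children of one set are disjoint.\<close>

lemma level_eq:
  assumes "I \<in> tree_level M C m" "J \<in> tree_level M C m" "I \<inter> J \<noteq> {}"
  shows "I = J"
  using assms
proof (induction m arbitrary: I J)
  case (Suc m)
  then obtain I' J' where *: "I' \<in> tree_level M C m" "J' \<in> tree_level M C m" "I \<in> C I'" "J \<in> C J'"
    by auto
  moreover have "I \<subseteq> I'" "J \<subseteq> J'" using * children level_in_tree by blast+
  ultimately have "I' = J'" using Suc by blast
  with * have "I \<in> C I'" "J \<in> C I'" "disjoint (C I')" using children level_in_tree by auto
  then show ?case using Suc.prems(3) unfolding disjoint_def by blast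
qed simp

lemma level_ancestor:
  assumes "I \<in> tree_level M C n" "m \<le> n"
  obtains J where "J \<in> tree_level M C m" "I \<subseteq> J"
proof -
  have "\<exists>J\<in>tree_level M C m. I \<subseteq> J" using assms
  proof (induction n arbitrary: I)
    case (Suc n)
    show ?case
    proof (cases "m = Suc n")
      case False
      from Suc.prems obtain I' where I': "I' \<in> tree_level M C n" "I \<in> C I'" by auto
      then have "I \<subseteq> I'" using children(4) level_in_tree by blast
      moreover have "m \<le> n" using Suc.prems False by simp
      ultimately show ?thesis using Suc.IH [OF I'(1)] by blast
    qed (use Suc.prems in auto)
  qed auto
  then show ?thesis using that by blast
qed

text \<open>If two tree sets meet, the ancestor of the deeper one on the level of the other meets
  that other set, hence equals it.\<close>

lemma tree_nested:
  assumes "I \<in> T" "J \<in> T"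
  shows "I \<inter> J = {} \<or> I \<subseteq> J \<or> J \<subseteq> I"
proof -
  have *: "I \<inter> J = {} \<or> J \<subseteq> I"
    if "I \<in> tree_level M C m" "J \<in> tree_level M C n" "m \<le> n" for I J m n
    using level_ancestor [OF that(2,3)] level_eq [OF that(1)] by (metis disjoint_iff subsetD)
  obtain m n where "I \<in> tree_level M C m" "J \<in> tree_level M C n"
    using assms tree_levels by blast
  then show ?thesis using * [of I m J n] * [of J n I m] by (metis Int_commute nat_le_linear)
qed

text \<open>Choose a superset of \<open>I\<close> in \<open>A\<close> on the least possible level. A
  larger member of \<open>A\<close> has an ancestor on that level, which meets the chosen set and so
  coincides with it.\<close>

lemma maximal_tree_set:
  assumes "I \<in> A" "A \<subseteq> T"
  obtains J where "J \<in> A" "I \<subseteq> J" "\<And>J'. J' \<in> A \<Longrightarrow> J \<subseteq> J' \<Longrightarrow> J' = J"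
proof -
  define P where "P n \<longleftrightarrow> (\<exists>J\<in>A. I \<subseteq> J \<and> J \<in> tree_level M C n)" for n
  have "\<exists>n. P n" using assms tree_levels unfolding P_def by blast
  then have "P (LEAST n. P n)" by (rule LeastI_ex)
  then obtain J where J: "J \<in> A" "I \<subseteq> J" "J \<in> tree_level M C (LEAST n. P n)"
    unfolding P_def by blast
  have "J' = J" if "J' \<in> A" "J \<subseteq> J'" for J'
  proof -
    have "J' \<in> T" using that(1) assms(2) by blast
    then obtain n where n: "J' \<in> tree_level M C n" using tree_levels by blast
    with that(1,2) J(2) have "P n" unfolding P_def by blast
    then have "(LEAST n. P n) \<le> n" by (rule Least_le)
    then obtain J'' where J'': "J'' \<in> tree_level M C (LEAST n. P n)" "J' \<subseteq> J''"
      using level_ancestor n by blast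
    have "J \<noteq> {}" using tree_pos J assms by fastforce
    then have "J = J''" using level_eq [OF J(3) J''(1)] that(2) J'' by blast
    then show ?thesis using J'' that(2) by blast
  qed
  then show ?thesis using that J by blast
qed

lemma small_tree_set:
  assumes "I \<in> T" "x \<in> I" "0 < d"
  obtains J where "J \<in> T" "x \<in> J" "J \<subseteq> I" "measure M J < d"
proof -
  have "(\<lambda>m. Sup (measure M ` tree_level M C m)) \<longlonglongrightarrow> 0"
    using tree by (auto simp: is_tree_def)
  \<comment> \<open>Including \<open>measure M I\<close> in the bound prevents the small set around
    \<open>x\<close> from containing \<open>I\<close>, so nesting places it inside
    \<open>I\<close>.\<close>
  then have "\<forall>\<^sub>F m in sequentially. Sup (measure M ` tree_level M C m) < min d (measure M I)"
    by (rule order_tendstoD) (use assms tree_pos in auto)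
  then obtain m where m: "Sup (measure M ` tree_level M C m) < min d (measure M I)"
    by (auto simp: eventually_sequentially)
  have "x \<in> space M" using assms tree_sets sets.sets_into_space by blast
  then obtain J where J: "J \<in> tree_level M C m" "x \<in> J" using level_cover [of m] by auto
  have "measure M J \<le> Sup (measure M ` tree_level M C m)"
    using J by (intro cSup_upper) (auto intro!: bdd_aboveI [where M = 1])
  with m have lt: "measure M J < d" "measure M J < measure M I" by auto
  have "J \<in> T" using J level_in_tree by blast
  moreover have "\<not> I \<subseteq> J"
    using lt \<open>J \<in> T\<close> finite_measure_mono [of I J] tree_sets by fastforce
  ultimately show ?thesis using that tree_nested [OF assms(1), of J] J assms(2) lt by blast
qed

subsection \<open>The weighted Doob inequality\<close>

text \<open>Finite version of the maximal function. The mean over the whole space is always present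
  as a floor; for non-negative \<open>\<phi>\<close> the zeros produced by the indicators therefore
  never decide the maximum.\<close>

definition partial_max :: "('a \<Rightarrow> real) \<Rightarrow> 'a set set \<Rightarrow> 'a \<Rightarrow> real" where
  "partial_max \<phi> G x = Max (insert (\<integral>y. \<phi> y \<partial>M) ((\<lambda>I. tree_avg M I \<phi> * indicator I x) ` G))"

lemma partial_max_empty [simp]: "partial_max \<phi> {} x = (\<integral>y. \<phi> y \<partial>M)"
  by (simp add: partial_max_def)

lemma partial_max_insert:
  "finite G \<Longrightarrow> partial_max \<phi> (insert J G) x = max (tree_avg M J \<phi> * indicator J x) (partial_max \<phi> G x)"
  unfolding partial_max_def image_insert by (subst insert_commute, subst Max_insert) auto

lemma partial_max_measurable [measurable]:
  assumes "finite G" "G \<subseteq> T"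
  shows "partial_max \<phi> G \<in> borel_measurable M"
  using assms
proof (induction G)
  case empty
  have "partial_max \<phi> {} = (\<lambda>_. \<integral>y. \<phi> y \<partial>M)" by auto
  then show ?case by simp
next
  case (insert J G)
  then have [measurable]: "J \<in> sets M" "partial_max \<phi> G \<in> borel_measurable M"
    using tree_sets by auto
  have "partial_max \<phi> (insert J G) = (\<lambda>x. max (tree_avg M J \<phi> * indicator J x) (partial_max \<phi> G x))"
    using insert partial_max_insert by auto
  then show ?case by simp
qed

lemma partial_max_bounded:
  assumes "finite G"
  obtains B where "\<And>x. partial_max \<phi> G x \<le> B"
proof -
  have "\<exists>B. \<forall>x. partial_max \<phi> G x \<le> B" using assms
  proof (induction G)
    case (insert J G)
    then obtain B where B: "\<And>x. partial_max \<phi> G x \<le> B" by blast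
    have "partial_max \<phi> (insert J G) x \<le> max \<bar>tree_avg M J \<phi>\<bar> B" for x
      unfolding partial_max_insert [OF insert(1)]
      by (intro max.mono B) (auto simp: indicator_def)
    then show ?case by blast
  qed auto
  then show ?thesis using that by blast
qed

lemma partial_max_mono:
  "finite H \<Longrightarrow> G \<subseteq> H \<Longrightarrow> partial_max \<phi> G x \<le> partial_max \<phi> H x"
  unfolding partial_max_def by (intro Max_mono) (auto intro: finite_subset)

lemma partial_max_ge_integral: "finite G \<Longrightarrow> (\<integral>y. \<phi> y \<partial>M) \<le> partial_max \<phi> G x"
  using partial_max_mono [of G "{}" \<phi> x] by simp

text \<open>By nesting, a member of \<open>G\<close> that meets \<open>J\<close> contains it, so no
  indicator in the maximum changes on \<open>J\<close>.\<close>

lemma partial_max_const_on_minimal: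
  assumes "G \<subseteq> T" "J \<in> T" "\<And>I. I \<in> G \<Longrightarrow> \<not> I \<subset> J" "x \<in> J" "y \<in> J"
  shows "partial_max \<phi> G x = partial_max \<phi> G y"
proof -
  have "indicator I x = (indicator I y :: real)" if "I \<in> G" for I
  proof (cases "I \<inter> J = {}")
    case False
    then have "J \<subseteq> I" using tree_nested [of I J] assms(1,2) assms(3) [OF that] that by blast
    then show ?thesis using assms(4,5) by (auto simp: indicator_def)
  qed (use assms in \<open>auto simp: indicator_def\<close>)
  then show ?thesis unfolding partial_max_def by (metis (no_types, lifting) image_cong)
qed

section \<open>Exhaustion of the tree by finite subfamilies\<close>

definition nth_family :: "nat \<Rightarrow> 'a set set" where
  "nth_family n = from_nat_into T ` {..<n}"

lemma tree_nonempty: "T \<noteq> {}"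
  using space_in_tree by auto

lemma nth_family: "finite (nth_family n)" "nth_family n \<subseteq> T"
  using from_nat_into [OF tree_nonempty] by (auto simp: nth_family_def)

lemma nth_family_mono: "m \<le> n \<Longrightarrow> nth_family m \<subseteq> nth_family n"
  by (auto simp: nth_family_def)

lemma in_nth_family:
  assumes "I \<in> T" obtains n where "I \<in> nth_family n"
proof -
  obtain k where "from_nat_into T k = I"
    using from_nat_into_surj [OF countable_tree assms] by blast
  then have "I \<in> nth_family (Suc k)" by (auto simp: nth_family_def)
  then show ?thesis using that by blast
qed

lemma tree_avg_space:
  assumes "\<And>x. x \<in> space M \<Longrightarrow> 0 \<le> \<phi> x"
  shows "tree_avg M (space M) \<phi> = (\<integral>y. \<phi> y \<partial>M)"
proof -
  have "(LINT y:space M|M. \<bar>\<phi> y\<bar>) = (\<integral>y. \<phi> y \<partial>M)"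
    unfolding set_lebesgue_integral_def using assms
    by (intro Bochner_Integration.integral_cong) auto
  then show ?thesis by (simp add: tree_avg_def prob_space)
qed

lemma tree_avg_nonneg: "0 \<le> tree_avg M I \<phi>"
  unfolding tree_avg_def set_lebesgue_integral_def
  by (intro divide_nonneg_nonneg integral_nonneg_AE) auto

text \<open>Turns the maximal function into a monotone limit of measurable functions. Each tree set
  enters some finite stage, and conversely the floor in \<open>partial_max\<close> is the average
  over \<open>space M\<close>.\<close>

lemma SUP_tree_avg_eq:
  assumes "\<And>x. x \<in> space M \<Longrightarrow> 0 \<le> \<phi> x" "x \<in> space M"
  shows "(SUP I\<in>{I\<in>T. x \<in> I}. ennreal (tree_avg M I \<phi>)) = (SUP n. ennreal (partial_max \<phi> (nth_family n) x))"
proof (rule antisym)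
  show "(SUP I\<in>{I\<in>T. x \<in> I}. ennreal (tree_avg M I \<phi>)) \<le> (SUP n. ennreal (partial_max \<phi> (nth_family n) x))"
  proof (rule SUP_least)
    fix I assume I: "I \<in> {I \<in> T. x \<in> I}"
    then obtain n where n: "I \<in> nth_family n" using in_nth_family by blast
    have "tree_avg M I \<phi> * indicator I x \<le> partial_max \<phi> (nth_family n) x"
      unfolding partial_max_def by (rule Max_ge) (use n nth_family in auto)
    then have "ennreal (tree_avg M I \<phi>) \<le> ennreal (partial_max \<phi> (nth_family n) x)"
      using I by (intro ennreal_leI) simp
    then show "ennreal (tree_avg M I \<phi>) \<le> (SUP n. ennreal (partial_max \<phi> (nth_family n) x))"
      by (rule SUP_upper2 [OF UNIV_I])
  qed
  have sp: "ennreal (\<integral>y. \<phi> y \<partial>M) \<le> (SUP I\<in>{I\<in>T. x \<in> I}. ennreal (tree_avg M I \<phi>))"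
    using assms by (intro SUP_upper2 [of "space M"]) (auto simp: space_in_tree tree_avg_space)
  show "(SUP n. ennreal (partial_max \<phi> (nth_family n) x)) \<le> (SUP I\<in>{I\<in>T. x \<in> I}. ennreal (tree_avg M I \<phi>))"
  proof (rule SUP_least)
    fix n
    have "partial_max \<phi> (nth_family n) x \<in> insert (\<integral>y. \<phi> y \<partial>M) ((\<lambda>I. tree_avg M I \<phi> * indicator I x) ` nth_family n)"
      unfolding partial_max_def by (rule Max_in) (use nth_family in auto)
    then consider "partial_max \<phi> (nth_family n) x = (\<integral>y. \<phi> y \<partial>M)"
      | I where "I \<in> nth_family n" "partial_max \<phi> (nth_family n) x = tree_avg M I \<phi> * indicator I x"
      by blast
    then show "ennreal (partial_max \<phi> (nth_family n) x) \<le> (SUP I\<in>{I\<in>T. x \<in> I}. ennreal (tree_avg M I \<phi>))"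
    proof cases
      case 2
      show ?thesis
      proof (cases "x \<in> I")
        case True
        then show ?thesis using 2 nth_family(2) by (intro SUP_upper2 [of I]) auto
      qed (use 2 in auto)
    qed (use sp in simp)
  qed
qed

lemma maxop_measurable [measurable]:
  assumes "\<And>x. x \<in> space M \<Longrightarrow> 0 \<le> \<phi> x"
  shows "maxop M T \<phi> \<in> borel_measurable M"
proof -
  have [measurable]: "partial_max \<phi> (nth_family n) \<in> borel_measurable M" for n
    by (simp add: nth_family)
  have "(\<lambda>x. enn2real (SUP n. ennreal (partial_max \<phi> (nth_family n) x))) \<in> borel_measurable M"
    by measurable
  then show ?thesis
    by (rule measurable_cong [THEN iffD1, rotated]) (simp add: maxop_def SUP_tree_avg_eq assms)
qed

section \<open>Doob's inequality over finite subfamilies\<close>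

context
  fixes \<phi> :: "'a \<Rightarrow> real" and p :: real
  assumes p: "p > 1"
    and phi_measurable [measurable]: "\<phi> \<in> borel_measurable M"
    and phi_nonneg: "\<And>x. x \<in> space M \<Longrightarrow> 0 \<le> \<phi> x"
    and phi_powr_integrable: "integrable M (\<lambda>x. \<phi> x powr p)"
begin

lemma phi_integrable: "integrable M \<phi>"
proof (rule Bochner_Integration.integrable_bound)
  show "integrable M (\<lambda>x. 1 + \<phi> x powr p)" using phi_powr_integrable by simp
  have "\<phi> x \<le> 1 + \<phi> x powr p" if "x \<in> space M" for x
  proof (cases "\<phi> x \<le> 1")
    case True
    then show ?thesis by (simp add: add_increasing2)
  next
    case False
    then have "\<phi> x powr 1 \<le> \<phi> x powr p" using p by (intro powr_mono) auto
    then show ?thesis using False by simp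
  qed
  then show "AE x in M. norm (\<phi> x) \<le> norm (1 + \<phi> x powr p)"
    using phi_nonneg by (intro AE_I2) (auto simp: abs_of_nonneg add_increasing2)
qed simp

lemma integral_phi_nonneg: "0 \<le> (\<integral>y. \<phi> y \<partial>M)"
  using phi_nonneg by (intro integral_nonneg_AE AE_I2) auto

lemma partial_max_nonneg: "finite G \<Longrightarrow> 0 \<le> partial_max \<phi> G x"
  using partial_max_ge_integral integral_phi_nonneg order_trans by blast

lemma tree_avg_times_measure:
  assumes "I \<in> T"
  shows "tree_avg M I \<phi> * measure M I = (\<integral>y. indicator I y * \<phi> y \<partial>M)"
proof -
  have "(LINT y:I|M. \<bar>\<phi> y\<bar>) = (\<integral>y. indicator I y * \<phi> y \<partial>M)"
    unfolding set_lebesgue_integral_def using phi_nonneg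
    by (intro Bochner_Integration.integral_cong) auto
  then show ?thesis using tree_pos [OF assms] by (simp add: tree_avg_def)
qed

lemma bounded_powr_integrable:
  fixes u g :: "'a \<Rightarrow> real" and B q :: real
  assumes [measurable]: "u \<in> borel_measurable M" and "\<And>x. 0 \<le> u x" "\<And>x. u x \<le> B" "q \<ge> 0" "integrable M g"
  shows "integrable M (\<lambda>x. g x * u x powr q)"
proof (rule Bochner_Integration.integrable_bound)
  show "integrable M (\<lambda>x. B powr q * g x)" using assms by simp
  show "(\<lambda>x. g x * u x powr q) \<in> borel_measurable M" using assms by measurable
  show "AE x in M. norm (g x * u x powr q) \<le> norm (B powr q * g x)"
  proof (rule AE_I2)
    fix x
    have "u x powr q \<le> B powr q" using assms by (intro powr_mono2) auto
    then have "\<bar>g x\<bar> * u x powr q \<le> \<bar>g x\<bar> * B powr q" by (rule mult_left_mono) simp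
    then show "norm (g x * u x powr q) \<le> norm (B powr q * g x)"
      by (simp add: abs_mult mult.commute)
  qed
qed

lemma doob_integrand_integrable:
  assumes "finite G" "G \<subseteq> T"
  shows "integrable M (\<lambda>x. p * (\<phi> x * partial_max \<phi> G x powr (p - 1)) - (p - 1) * partial_max \<phi> G x powr p)"
    "integrable M (\<lambda>x. \<phi> x * partial_max \<phi> G x powr (p - 1))"
    "integrable M (\<lambda>x. partial_max \<phi> G x powr p)"
proof -
  note [measurable] = partial_max_measurable [OF assms]
  obtain B where B: "\<And>x. partial_max \<phi> G x \<le> B" using partial_max_bounded assms by blast
  show 1: "integrable M (\<lambda>x. \<phi> x * partial_max \<phi> G x powr (p - 1))"
    by (rule bounded_powr_integrable [OF _ _ B]) (use p phi_integrable partial_max_nonneg assms in auto)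
  have "integrable M (\<lambda>x. 1 * partial_max \<phi> G x powr p)"
    by (rule bounded_powr_integrable [OF _ _ B]) (use p partial_max_nonneg assms in auto)
  then show 2: "integrable M (\<lambda>x. partial_max \<phi> G x powr p)" by simp
  show "integrable M (\<lambda>x. p * (\<phi> x * partial_max \<phi> G x powr (p - 1)) - (p - 1) * partial_max \<phi> G x powr p)"
    using 1 2 by (intro Bochner_Integration.integrable_diff integrable_mult_right) auto
qed

text \<open>Induction on \<open>G\<close>, removing a set \<open>J\<close> minimal under inclusion: the maximal function of the
  rest is constant on \<open>J\<close>, so putting \<open>J\<close> back costs nothing by Young's inequality.\<close>

lemma doob_finite:
  assumes "finite G" "G \<subseteq> T"
  shows "(\<integral>y. \<phi> y \<partial>M) powr p \<le>
    (\<integral>x. p * (\<phi> x * partial_max \<phi> G x powr (p - 1)) - (p - 1) * partial_max \<phi> G x powr p \<partial>M)"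
  using assms
proof (induction G rule: finite_psubset_induct)
  case (psubset G)
  let ?f = "\<integral>y. \<phi> y \<partial>M"
  let ?H = "\<lambda>G x. p * (\<phi> x * partial_max \<phi> G x powr (p - 1)) - (p - 1) * partial_max \<phi> G x powr p"
  show ?case
  proof (cases "G = {}")
    case True
    \<comment> \<open>Here the partial maximum is the constant \<open>?f\<close>, and equality holds
      because \<open>p - (p - 1) = 1\<close>.\<close>
    have "?f powr p = ?f * ?f powr (p - 1)"
      using integral_phi_nonneg p by (cases "?f = 0") (auto simp: powr_mult_base)
    moreover have "(\<integral>x. ?H {} x \<partial>M) = p * (?f * ?f powr (p - 1)) - (p - 1) * ?f powr p"
      using phi_integrable by (simp add: prob_space)
    ultimately show ?thesis using True by (simp add: algebra_simps)
  next
    case False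
    from finite_has_minimal [OF psubset.hyps(1) False]
    obtain J where J: "J \<in> G" and "\<forall>I\<in>G. I \<subseteq> J \<longrightarrow> J = I" by (elim bexE)
    then have Jmin: "\<And>I. I \<in> G \<Longrightarrow> I \<subseteq> J \<Longrightarrow> J = I" by blast
    have JT: "J \<in> T" using J psubset by auto
    note [measurable] = tree_sets [OF JT]
    define G' where "G' = G - {J}"
    have G': "finite G'" "G' \<subseteq> T" "G' \<subset> G" "G = insert J G'"
      using J psubset by (auto simp: G'_def)
    obtain z where z: "z \<in> J" using tree_pos [OF JT] by fastforce
    \<comment> \<open>On \<open>J\<close> the maximum is the constant \<open>m\<close> before
      \<open>J\<close> is added and \<open>b\<close> afterwards.\<close>
    define a m where "a = tree_avg M J \<phi>" and "m = partial_max \<phi> G' z"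
    define b where "b = max a m"
    have a: "a \<ge> 0" and m: "m \<ge> 0"
      unfolding a_def m_def by (rule tree_avg_nonneg, rule partial_max_nonneg [OF G'(1)])
    have const: "partial_max \<phi> G' x = m" if "x \<in> J" for x
      unfolding m_def
    proof (rule partial_max_const_on_minimal [OF G'(2) JT _ that z])
      show "\<not> I \<subset> J" if "I \<in> G'" for I using that Jmin G'(3) by blast
    qed
    \<comment> \<open>Adding \<open>J\<close> changes the integrand only on \<open>J\<close>, by
      \<open>c * \<phi> - d\<close>.\<close>
    define c d where "c = p * (b powr (p - 1) - m powr (p - 1))" and "d = (p - 1) * (b powr p - m powr p)"
    have diff: "?H G x - ?H G' x = c * (indicator J x * \<phi> x) - d * indicator J x" for x
    proof (cases "x \<in> J")
      case True
      then show ?thesis unfolding G'(4) partial_max_insert [OF G'(1)]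
        by (simp add: const a_def [symmetric] b_def [symmetric] c_def d_def algebra_simps)
    next
      case False
      then have "partial_max \<phi> G x = partial_max \<phi> G' x"
        unfolding G'(4) partial_max_insert [OF G'(1)]
        using partial_max_nonneg [OF G'(1), of x] by simp
      then show ?thesis using False by simp
    qed
    have int: "integrable M (\<lambda>x. indicator J x * \<phi> x)"
      using integrable_mult_indicator [OF tree_sets [OF JT] phi_integrable] by simp
    have intJ: "integrable M (indicator J :: 'a \<Rightarrow> real)"
      by (intro integrable_real_indicator) (auto simp: emeasure_eq_measure)
    have "(\<integral>x. ?H G x \<partial>M) - (\<integral>x. ?H G' x \<partial>M) = (\<integral>x. ?H G x - ?H G' x \<partial>M)"
      by (intro Bochner_Integration.integral_diff [symmetric] doob_integrand_integrable(1))
        (use G'(1,2) psubset in auto)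
    also have "\<dots> = c * (a * measure M J) - d * measure M J"
      unfolding diff a_def tree_avg_times_measure [OF JT]
      using int intJ by (subst Bochner_Integration.integral_diff) auto
    also have "\<dots> = measure M J * (c * a - d)" by (simp add: algebra_simps)
    also have "\<dots> \<ge> 0"
    proof (rule mult_nonneg_nonneg)
      \<comment> \<open>If \<open>a \<le> m\<close>, nothing changes. Otherwise
        \<open>b = a\<close>, and the difference is the gap in Young's inequality for
        \<open>a\<close> and \<open>m\<close>.\<close>
      show "0 \<le> c * a - d"
      proof (cases "a \<le> m")
        case True
        then show ?thesis by (simp add: c_def d_def b_def max_def)
      next
        case False
        then have "b = a" "a > 0" using m by (auto simp: b_def)
        moreover have "a * a powr (p - 1) = a powr p"
          using \<open>a > 0\<close> by (simp add: powr_mult_base)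
        ultimately have "c * a - d = a powr p + (p - 1) * m powr p - p * a * m powr (p - 1)"
          by (simp add: c_def d_def algebra_simps)
        then show ?thesis using young_powr [OF p a m] by simp
      qed
    qed simp
    finally show ?thesis using psubset.IH [OF G'(3,2)] by simp
  qed
qed

text \<open>Young's inequality with the pointwise weight \<open>w x\<close> splits the mixed term.
  It spends \<open>(p - 1) / w x\<close> of the available \<open>p - 1\<close> copies of the maximal
  term and leaves \<open>(p - 1) * (1 - 1 / w x)\<close>; the bound \<open>W\<close> secures
  integrability.\<close>

lemma doob_finite_weighted:
  assumes "finite G" "G \<subseteq> T"
    and [measurable]: "w \<in> borel_measurable M" and w: "\<And>x. 1 \<le> w x" "\<And>x. w x \<le> W"
  shows "(\<integral>y. \<phi> y \<partial>M) powr p \<le>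
    (\<integral>x. w x powr (p - 1) * \<phi> x powr p \<partial>M) - (\<integral>x. (p - 1) * (1 - 1 / w x) * partial_max \<phi> G x powr p \<partial>M)"
proof -
  note [measurable] = partial_max_measurable [OF assms(1,2)]
  have w0: "0 \<le> w x" for x using w(1) [of x] by simp
  have i1: "integrable M (\<lambda>x. w x powr (p - 1) * \<phi> x powr p)"
  proof -
    have "integrable M (\<lambda>x. \<phi> x powr p * w x powr (p - 1))"
      by (rule bounded_powr_integrable [OF _ w0 w(2) _ phi_powr_integrable]) (use p in auto)
    then show ?thesis by (simp add: mult.commute)
  qed
  have i2: "integrable M (\<lambda>x. (p - 1) * (1 - 1 / w x) * partial_max \<phi> G x powr p)"
  proof (rule Bochner_Integration.integrable_bound)
    show "integrable M (\<lambda>x. (p - 1) * partial_max \<phi> G x powr p)"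
      using doob_integrand_integrable(3) assms by (intro integrable_mult_right) auto
    have "\<bar>1 - 1 / w x\<bar> \<le> 1" for x using w(1) [of x] by (auto simp: abs_if field_simps)
    then have "\<bar>1 - 1 / w x\<bar> * partial_max \<phi> G x powr p \<le> 1 * partial_max \<phi> G x powr p" for x
      by (rule mult_right_mono) simp
    then show "AE x in M. norm ((p - 1) * (1 - 1 / w x) * partial_max \<phi> G x powr p)
        \<le> norm ((p - 1) * partial_max \<phi> G x powr p)"
      using p by (intro AE_I2) (simp add: abs_mult mult.assoc)
  qed simp
  have "(\<integral>y. \<phi> y \<partial>M) powr p \<le>
    (\<integral>x. p * (\<phi> x * partial_max \<phi> G x powr (p - 1)) - (p - 1) * partial_max \<phi> G x powr p \<partial>M)"
    by (rule doob_finite [OF assms(1,2)])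
  also have "\<dots> \<le> (\<integral>x. w x powr (p - 1) * \<phi> x powr p - (p - 1) * (1 - 1 / w x) * partial_max \<phi> G x powr p \<partial>M)"
  proof (rule integral_mono)
    show "integrable M (\<lambda>x. p * (\<phi> x * partial_max \<phi> G x powr (p - 1)) - (p - 1) * partial_max \<phi> G x powr p)"
      using doob_integrand_integrable(1) assms by auto
    show "integrable M (\<lambda>x. w x powr (p - 1) * \<phi> x powr p - (p - 1) * (1 - 1 / w x) * partial_max \<phi> G x powr p)"
      using i1 i2 by (rule Bochner_Integration.integrable_diff)
    fix x assume "x \<in> space M"
    then show "p * (\<phi> x * partial_max \<phi> G x powr (p - 1)) - (p - 1) * partial_max \<phi> G x powr p
      \<le> w x powr (p - 1) * \<phi> x powr p - (p - 1) * (1 - 1 / w x) * partial_max \<phi> G x powr p"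
      using young_powr_weighted [of p "\<phi> x" "partial_max \<phi> G x" "w x"] p phi_nonneg
        partial_max_nonneg [OF assms(1)] w(1) [of x] by (simp add: algebra_simps)
  qed
  also have "\<dots> = (\<integral>x. w x powr (p - 1) * \<phi> x powr p \<partial>M) - (\<integral>x. (p - 1) * (1 - 1 / w x) * partial_max \<phi> G x powr p \<partial>M)"
    using i1 i2 by (rule Bochner_Integration.integral_diff)
  finally show ?thesis .
qed

section \<open>Passage from finite subfamilies to the whole tree\<close>

lemma nn_integral_SUP_partial_max:
  "(\<integral>\<^sup>+ x. (SUP n. ennreal (partial_max \<phi> (nth_family n) x powr p)) \<partial>M) < \<infinity>"
proof -
  let ?m = "\<lambda>n. partial_max \<phi> (nth_family n)"
  have [measurable]: "?m n \<in> borel_measurable M" for n by (simp add: nth_family)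
  \<comment> \<open>The constant weight 2 leaves the positive coefficient \<open>(p - 1) / 2\<close>
    on the maximal term, hence a bound uniform in \<open>n\<close>.\<close>
  define B where "B = 2 powr (p - 1) * (\<integral>x. \<phi> x powr p \<partial>M) / ((p - 1) / 2)"
  have "(\<integral>x. ?m n x powr p \<partial>M) \<le> B" for n
  proof -
    have "0 \<le> (\<integral>y. \<phi> y \<partial>M) powr p" by simp
    also have "\<dots> \<le> 2 powr (p - 1) * (\<integral>x. \<phi> x powr p \<partial>M) - (p - 1) / 2 * (\<integral>x. ?m n x powr p \<partial>M)"
      using doob_finite_weighted [OF nth_family, of "\<lambda>_. 2" 2 n] by simp
    finally have "(p - 1) / 2 * (\<integral>x. ?m n x powr p \<partial>M) \<le> 2 powr (p - 1) * (\<integral>x. \<phi> x powr p \<partial>M)"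
      by simp
    then show ?thesis unfolding B_def using p by (subst pos_le_divide_eq) (auto simp: mult.commute)
  qed
  then have bd: "(\<integral>\<^sup>+ x. ennreal (?m n x powr p) \<partial>M) \<le> ennreal B" for n
    by (subst nn_integral_eq_integral) (auto intro!: doob_integrand_integrable(3) nth_family ennreal_leI)
  have "(\<integral>\<^sup>+ x. (SUP n. ennreal (?m n x powr p)) \<partial>M) = (SUP n. \<integral>\<^sup>+ x. ennreal (?m n x powr p) \<partial>M)"
  proof (rule nn_integral_monotone_convergence_SUP)
    show "incseq (\<lambda>n x. ennreal (?m n x powr p))"
      using p by (intro incseq_SucI le_funI ennreal_leI powr_mono2)
        (auto intro!: partial_max_nonneg partial_max_mono nth_family nth_family_mono)
  qed simp
  also have "\<dots> \<le> ennreal B" using bd by (intro SUP_least)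
  finally show ?thesis using le_less_trans by fastforce
qed

text \<open>\<open>enn2real\<close> sends \<infinity> to 0, so convergence to \<open>maxop\<close>
  needs the supremum to be finite. Almost everywhere it is, since the supremum of the
  \<open>p\<close>-th powers is integrable and \<open>t \<le> 1 + t powr p\<close>.\<close>

lemma maxop_limit:
  "AE x in M. (SUP I\<in>{I\<in>T. x \<in> I}. ennreal (tree_avg M I \<phi>)) < \<infinity> \<and>
     (\<lambda>n. partial_max \<phi> (nth_family n) x) \<longlonglongrightarrow> maxop M T \<phi> x"
proof -
  let ?m = "\<lambda>n. partial_max \<phi> (nth_family n)"
  have [measurable]: "?m n \<in> borel_measurable M" for n by (simp add: nth_family)
  have "AE x in M. (SUP n. ennreal (?m n x powr p)) \<noteq> \<infinity>"
    using nn_integral_SUP_partial_max by (intro nn_integral_noteq_infinite) auto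
  then show ?thesis
  proof (rule AE_mp, intro AE_I2 impI)
    fix x assume x: "x \<in> space M" and fin: "(SUP n. ennreal (?m n x powr p)) \<noteq> \<infinity>"
    have le: "?m n x \<le> 1 + ?m n x powr p" for n
    proof (cases "?m n x \<le> 1")
      case False
      then have "?m n x powr 1 \<le> ?m n x powr p" using p by (intro powr_mono) auto
      then show ?thesis using False by simp
    qed (simp add: add_increasing2)
    have "(SUP n. ennreal (?m n x)) \<le> 1 + (SUP n. ennreal (?m n x powr p))"
    proof (rule SUP_least)
      fix n
      have "ennreal (?m n x) \<le> 1 + ennreal (?m n x powr p)"
        using ennreal_leI [OF le [of n]] by simp
      also have "\<dots> \<le> 1 + (SUP n. ennreal (?m n x powr p))"
        by (intro add_left_mono SUP_upper) simp
      finally show "ennreal (?m n x) \<le> 1 + (SUP n. ennreal (?m n x powr p))" .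
    qed
    also have "1 + R < \<infinity>" if "R \<noteq> \<infinity>" for R :: ennreal
      using that by (simp add: less_top)
    note this [OF fin]
    finally have lt: "(SUP n. ennreal (?m n x)) < \<infinity>" .
    have "(\<lambda>n. ennreal (?m n x)) \<longlonglongrightarrow> (SUP n. ennreal (?m n x))"
      by (intro LIMSEQ_SUP incseq_SucI ennreal_leI partial_max_mono nth_family nth_family_mono) simp
    then have "(\<lambda>n. enn2real (ennreal (?m n x))) \<longlonglongrightarrow> enn2real (SUP n. ennreal (?m n x))"
      using lt by (intro tendsto_enn2real) auto
    then show "(SUP I\<in>{I\<in>T. x \<in> I}. ennreal (tree_avg M I \<phi>)) < \<infinity> \<and> (\<lambda>n. ?m n x) \<longlonglongrightarrow> maxop M T \<phi> x"
      using lt x by (simp add: maxop_def SUP_tree_avg_eq phi_nonneg partial_max_nonneg nth_family)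
  qed
qed

lemma maxop_powr_integrable: "integrable M (\<lambda>x. maxop M T \<phi> x powr p)"
proof (rule integrableI_nonneg)
  note [measurable] = maxop_measurable [OF phi_nonneg]
  show "(\<lambda>x. maxop M T \<phi> x powr p) \<in> borel_measurable M" by measurable
  have "(\<integral>\<^sup>+ x. ennreal (maxop M T \<phi> x powr p) \<partial>M)
      \<le> (\<integral>\<^sup>+ x. (SUP n. ennreal (partial_max \<phi> (nth_family n) x powr p)) \<partial>M)"
  proof (rule nn_integral_mono_AE, use maxop_limit in eventually_elim)
    case (elim x)
    then have "(\<lambda>n. partial_max \<phi> (nth_family n) x powr p) \<longlonglongrightarrow> maxop M T \<phi> x powr p"
      using p by (intro tendsto_powr') (auto intro!: always_eventually partial_max_nonneg nth_family)
    then have "(\<lambda>n. ennreal (partial_max \<phi> (nth_family n) x powr p)) \<longlonglongrightarrow> ennreal (maxop M T \<phi> x powr p)"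
      by (rule tendsto_ennrealI)
    then show ?case by (rule LIMSEQ_le_const2) (auto intro!: exI SUP_upper)
  qed
  then show "(\<integral>\<^sup>+ x. ennreal (maxop M T \<phi> x powr p) \<partial>M) < \<infinity>"
    using nn_integral_SUP_partial_max by (rule le_less_trans)
qed auto

text \<open>Dominated convergence in the finite inequality: the partial maxima increase to
  \<open>maxop\<close>, whose \<open>p\<close>-th power is integrable, and
  \<open>1 - 1 / w x\<close> lies between 0 and 1.\<close>

lemma doob_weighted:
  assumes [measurable]: "w \<in> borel_measurable M" and w: "\<And>x. 1 \<le> w x" "\<And>x. w x \<le> W"
  shows "(\<integral>y. \<phi> y \<partial>M) powr p \<le>
    (\<integral>x. w x powr (p - 1) * \<phi> x powr p \<partial>M) - (\<integral>x. (p - 1) * (1 - 1 / w x) * maxop M T \<phi> x powr p \<partial>M)"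
proof (rule LIMSEQ_le_const)
  note [measurable] = maxop_measurable [OF phi_nonneg]
  let ?m = "\<lambda>n. partial_max \<phi> (nth_family n)"
  have [measurable]: "?m n \<in> borel_measurable M" for n by (simp add: nth_family)
  have "(\<lambda>n. \<integral>x. (p - 1) * (1 - 1 / w x) * ?m n x powr p \<partial>M)
      \<longlonglongrightarrow> (\<integral>x. (p - 1) * (1 - 1 / w x) * maxop M T \<phi> x powr p \<partial>M)"
  proof (rule integral_dominated_convergence)
    show "integrable M (\<lambda>x. (p - 1) * maxop M T \<phi> x powr p)"
      using maxop_powr_integrable by simp
    show "AE x in M. (\<lambda>n. (p - 1) * (1 - 1 / w x) * ?m n x powr p)
        \<longlonglongrightarrow> (p - 1) * (1 - 1 / w x) * maxop M T \<phi> x powr p"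
      using maxop_limit
    proof eventually_elim
      case (elim x)
      then show ?case
        using p by (intro tendsto_mult_left tendsto_powr')
          (auto intro!: always_eventually partial_max_nonneg nth_family)
    qed
    fix n
    show "AE x in M. norm ((p - 1) * (1 - 1 / w x) * ?m n x powr p) \<le> (p - 1) * maxop M T \<phi> x powr p"
      using maxop_limit
    proof eventually_elim
      case (elim x)
      have "incseq (\<lambda>n. ?m n x)"
        by (intro incseq_SucI partial_max_mono nth_family nth_family_mono) simp
      then have "?m n x \<le> maxop M T \<phi> x" using elim incseq_le by blast
      then have "?m n x powr p \<le> maxop M T \<phi> x powr p"
        using p by (intro powr_mono2) (auto intro!: partial_max_nonneg nth_family)
      moreover have "\<bar>1 - 1 / w x\<bar> \<le> 1" using w(1) [of x] by (auto simp: abs_if field_simps)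
      ultimately have "(p - 1) * (\<bar>1 - 1 / w x\<bar> * ?m n x powr p) \<le> (p - 1) * (1 * maxop M T \<phi> x powr p)"
        using p by (intro mult_left_mono mult_mono) auto
      then show ?case using p by (simp add: abs_mult mult.assoc)
    qed
  qed simp_all
  then show "(\<lambda>n. (\<integral>x. w x powr (p - 1) * \<phi> x powr p \<partial>M) - (\<integral>x. (p - 1) * (1 - 1 / w x) * ?m n x powr p \<partial>M))
    \<longlonglongrightarrow> (\<integral>x. w x powr (p - 1) * \<phi> x powr p \<partial>M) - (\<integral>x. (p - 1) * (1 - 1 / w x) * maxop M T \<phi> x powr p \<partial>M)"
    by (intro tendsto_intros)
  show "\<exists>N. \<forall>n\<ge>N. (\<integral>y. \<phi> y \<partial>M) powr p \<le>
    (\<integral>x. w x powr (p - 1) * \<phi> x powr p \<partial>M) - (\<integral>x. (p - 1) * (1 - 1 / w x) * ?m n x powr p \<partial>M)"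
    using doob_finite_weighted [OF nth_family _ w] by simp
qed

section \<open>The inequality with parameters \<open>\<beta>\<close>, \<open>\<gamma>\<close> and a
  set \<open>K\<close>\<close>

lemma maxop_inequality:
  assumes "\<beta> \<ge> \<gamma>" "\<gamma> \<ge> 0" and [measurable]: "K \<in> sets M"
  shows "(\<integral>x. \<phi> x powr p \<partial>M) \<ge> (1 - 1 / (1 + \<gamma>) powr (p - 1)) * (LINT x:K|M. \<phi> x powr p)
                 + (p - 1) * \<beta> / (\<beta> + 1) powr p * (LINT x|M. maxop M T \<phi> x powr p)
                 - (p - 1) * \<gamma> / (\<beta> + 1) powr p * (LINT x:K|M. maxop M T \<phi> x powr p)
                 + (\<integral>x. \<phi> x \<partial>M) powr p / (\<beta> + 1) powr (p - 1)"
proof -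
  define s where "s = \<beta> + 1"
  have s: "s > 0" "\<beta> = s - 1" "s \<ge> 1 + \<gamma>" using assms by (auto simp: s_def)
  \<comment> \<open>These two weights turn Young's inequality into exactly the coefficients of the claim.\<close>
  define w where "w x = (if x \<in> K then s / (1 + \<gamma>) else s)" for x
  have [measurable]: "w \<in> borel_measurable M" unfolding w_def by measurable
  define \<Phi> where "\<Phi> = (\<integral>x. \<phi> x powr p \<partial>M)"
  define \<Phi>K where "\<Phi>K = (\<integral>x. indicator K x * \<phi> x powr p \<partial>M)"
  define N where "N = (\<integral>x. maxop M T \<phi> x powr p \<partial>M)"
  define NK where "NK = (\<integral>x. indicator K x * maxop M T \<phi> x powr p \<partial>M)"
  define f where "f = (\<integral>x. \<phi> x \<partial>M)"
  define e where "e = 1 / (1 + \<gamma>) powr (p - 1)"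
  have i1: "integrable M (\<lambda>x. indicator K x * \<phi> x powr p)"
    using integrable_mult_indicator [OF assms(3) phi_powr_integrable] by simp
  have i2: "integrable M (\<lambda>x. indicator K x * maxop M T \<phi> x powr p)"
    using integrable_mult_indicator [OF assms(3) maxop_powr_integrable] by simp
  have "w x powr (p - 1) * \<phi> x powr p
      = s powr (p - 1) * \<phi> x powr p - s powr (p - 1) * (1 - e) * (indicator K x * \<phi> x powr p)" for x
    using s assms by (auto simp: w_def powr_divide e_def algebra_simps)
  then have "(\<integral>x. w x powr (p - 1) * \<phi> x powr p \<partial>M) = s powr (p - 1) * \<Phi> - s powr (p - 1) * (1 - e) * \<Phi>K"
    using phi_powr_integrable i1 by (simp add: \<Phi>_def \<Phi>K_def)
  moreover have w': "1 - 1 / w x = \<beta> / s - \<gamma> / s * indicator K x" for x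
    using s(1) by (auto simp: w_def s(2) diff_divide_distrib add_divide_distrib)
  have "(p - 1) * (1 - 1 / w x) * maxop M T \<phi> x powr p
      = (p - 1) * \<beta> / s * (maxop M T \<phi> x powr p) - (p - 1) * \<gamma> / s * (indicator K x * maxop M T \<phi> x powr p)" for x
    unfolding w' by (simp add: algebra_simps)
  then have "(\<integral>x. (p - 1) * (1 - 1 / w x) * maxop M T \<phi> x powr p \<partial>M)
      = (p - 1) * \<beta> / s * N - (p - 1) * \<gamma> / s * NK"
    using maxop_powr_integrable i2 by (simp add: N_def NK_def)
  \<comment> \<open>On \<open>K\<close> the lower bound is exactly
    \<open>\<gamma> \<le> \<beta>\<close>, and the upper bound is
    \<open>0 \<le> \<gamma>\<close>.\<close>
  moreover have "1 \<le> w x" "w x \<le> s" for x using s assms by (auto simp: w_def field_simps)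
  ultimately have "f powr p \<le> s powr (p - 1) * \<Phi> - s powr (p - 1) * (1 - e) * \<Phi>K
      - ((p - 1) * \<beta> / s * N - (p - 1) * \<gamma> / s * NK)"
    using doob_weighted [of w s] by (simp add: f_def)
  \<comment> \<open>Dividing by \<open>s powr (p - 1)\<close> normalises the coefficient of
    \<open>\<Phi>\<close> to 1 and turns each \<open>1 / s\<close> into
    \<open>1 / s powr p\<close>.\<close>
  then have "f powr p / s powr (p - 1) \<le> (s powr (p - 1) * \<Phi> - s powr (p - 1) * (1 - e) * \<Phi>K
      - ((p - 1) * \<beta> / s * N - (p - 1) * \<gamma> / s * NK)) / s powr (p - 1)"
    by (rule divide_right_mono) simp
  also have "\<dots> = \<Phi> - (1 - e) * \<Phi>K - ((p - 1) * \<beta> / s * N - (p - 1) * \<gamma> / s * NK) / s powr (p - 1)"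
    using s by (simp add: diff_divide_distrib)
  also have "((p - 1) * \<beta> / s * N - (p - 1) * \<gamma> / s * NK) / s powr (p - 1)
      = (p - 1) * \<beta> / s powr p * N - (p - 1) * \<gamma> / s powr p * NK"
    using s by (simp add: powr_diff field_simps)
  finally show ?thesis
    unfolding set_lebesgue_integral_def s_def [symmetric]
    by (simp add: \<Phi>_def [symmetric] \<Phi>K_def [symmetric] N_def [symmetric]
        NK_def [symmetric] f_def [symmetric] e_def [symmetric] algebra_simps)
qed

end

subsection \<open>Extremal functions\<close>

text \<open>These are the unions of tree sets, the empty one included. The pointwise form makes
  closure under arbitrary unions immediate, and countability of the tree gives
  measurability.\<close>

definition tree_open :: "'a set \<Rightarrow> bool" where
  "tree_open S \<longleftrightarrow> (\<forall>x\<in>S. \<exists>I\<in>T. x \<in> I \<and> I \<subseteq> S)"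

lemma tree_open_tree: "I \<in> T \<Longrightarrow> tree_open I"
  by (auto simp: tree_open_def)

lemma tree_open_Union: "(\<And>S. S \<in> \<S> \<Longrightarrow> tree_open S) \<Longrightarrow> tree_open (\<Union> \<S>)"
  unfolding tree_open_def by (meson Union_iff Union_upper subset_trans)

lemma tree_open_Un: "tree_open S \<Longrightarrow> tree_open S' \<Longrightarrow> tree_open (S \<union> S')"
  using tree_open_Union [of "{S, S'}"] by auto

lemma tree_open_sets [measurable]:
  assumes "tree_open S"
  shows "S \<in> sets M"
proof -
  have "S = \<Union> {I \<in> T. I \<subseteq> S}" using assms by (auto simp: tree_open_def)
  moreover have "\<Union> {I \<in> T. I \<subseteq> S} \<in> sets M"
    using countable_tree tree_sets by (intro sets.countable_Union) (auto intro: countable_subset)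
  ultimately show ?thesis by simp
qed

text \<open>For tree-open \<open>S\<close> these sets form a countable partition of
  \<open>S\<close>, and every tree set inside \<open>S\<close> lies in one of them.\<close>

definition max_sets :: "'a set \<Rightarrow> 'a set set" where
  "max_sets S = {I \<in> T. I \<subseteq> S \<and> (\<forall>J\<in>T. J \<subseteq> S \<longrightarrow> I \<subseteq> J \<longrightarrow> J = I)}"

lemma max_setsD: "I \<in> max_sets S \<Longrightarrow> I \<in> T" "I \<in> max_sets S \<Longrightarrow> I \<subseteq> S"
  by (auto simp: max_sets_def)

lemma max_sets_superset:
  assumes "I \<in> T" "I \<subseteq> S"
  obtains J where "J \<in> max_sets S" "I \<subseteq> J"
proof (rule maximal_tree_set [of I "{J \<in> T. J \<subseteq> S}"])
  fix J assume "J \<in> {J \<in> T. J \<subseteq> S}" "I \<subseteq> J" "\<And>J'. J' \<in> {J \<in> T. J \<subseteq> S} \<Longrightarrow> J \<subseteq> J' \<Longrightarrow> J' = J"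
  then show thesis by (intro that [of J]) (auto simp: max_sets_def)
qed (use assms in auto)

lemma Union_max_sets: "tree_open S \<Longrightarrow> \<Union> (max_sets S) = S"
  unfolding tree_open_def by (auto dest: max_setsD) (meson max_sets_superset subsetD)

lemma max_sets_disjoint: "I \<in> max_sets S \<Longrightarrow> J \<in> max_sets S \<Longrightarrow> I = J \<or> I \<inter> J = {}"
  using tree_nested [of I J] unfolding max_sets_def by blast

lemma countable_max_sets: "countable (max_sets S)"
  by (rule countable_subset [OF _ countable_tree]) (auto simp: max_sets_def)

lemma max_sets_space: "max_sets (space M) = {space M}"
  using space_in_tree tree_sets sets.sets_into_space by (fastforce simp: max_sets_def)

text \<open>Greedy choice: run through an enumeration of the tree, adding a set to the union
  whenever the measure stays at most \<open>t\<close>. A positive deficit would force every sufficiently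
  small tree set to be added, hence all of \<open>I\<close>.\<close>

lemma tree_open_subset_of_measure:
  assumes I: "I \<in> T" and t: "0 < t" "t < measure M I"
  obtains U where "tree_open U" "U \<subseteq> I" "measure M U = t"
proof -
  define e where "e = from_nat_into T"
  have e: "e n \<in> T" for n by (simp add: e_def from_nat_into tree_nonempty)
  define V where "V = rec_nat {} (\<lambda>n W. if e n \<subseteq> I \<and> measure M (W \<union> e n) \<le> t then W \<union> e n else W)"
  have V0: "V 0 = {}" and VS: "V (Suc n) = (if e n \<subseteq> I \<and> measure M (V n \<union> e n) \<le> t then V n \<union> e n else V n)" for n
    by (simp_all add: V_def)
  have op: "tree_open (V n)" for n
    by (induction n) (auto simp: V0 VS tree_open_def [of "{}"] intro: tree_open_Un tree_open_tree e)
  have sub: "V n \<subseteq> I" for n by (induction n) (auto simp: V0 VS)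
  have le: "measure M (V n) \<le> t" for n by (induction n) (use t in \<open>auto simp: V0 VS\<close>)
  have inc: "incseq V" by (intro incseq_SucI) (auto simp: VS)
  define U where "U = (\<Union>n. V n)"
  have U: "tree_open U" "U \<subseteq> I" using op sub by (auto simp: U_def intro!: tree_open_Union)
  have [measurable]: "V n \<in> sets M" "U \<in> sets M" for n using op U tree_open_sets by auto
  have "(\<lambda>n. measure M (V n)) \<longlonglongrightarrow> measure M U"
    unfolding U_def by (rule finite_Lim_measure_incseq) (use inc in auto)
  then have Ut: "measure M U \<le> t" by (rule LIMSEQ_le_const2) (use le in auto)
  have "\<not> measure M U < t"
  proof
    assume lt: "measure M U < t"
    have "I \<subseteq> U"
    proof
      fix x assume "x \<in> I"
      then obtain J where J: "J \<in> T" "x \<in> J" "J \<subseteq> I" "measure M J < t - measure M U"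
        using small_tree_set [OF I, of x "t - measure M U"] lt by auto
      then obtain n where n: "e n = J"
        using from_nat_into_surj [OF countable_tree] unfolding e_def by blast
      have "measure M (V n \<union> J) \<le> measure M (V n) + measure M J"
        by (rule measure_Un_le) (use J tree_sets in auto)
      also have "measure M (V n) \<le> measure M U"
        by (rule finite_measure_mono) (auto simp: U_def)
      finally have "J \<subseteq> V (Suc n)" using J n by (auto simp: VS)
      then show "x \<in> U" using J by (auto simp: U_def)
    qed
    then have "measure M I \<le> measure M U" by (intro finite_measure_mono) auto
    then show False using Ut t by simp
  qed
  then show ?thesis using that U Ut by force
qed

section \<open>A nested sequence of tree-open sets with constant proportion
  \<open>\<theta>\<close>\<close>

context
  fixes \<theta> :: real
  assumes \<theta>: "0 < \<theta>" "\<theta> < 1"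
begin

definition thin :: "'a set \<Rightarrow> 'a set" where
  "thin I = (SOME U. tree_open U \<and> U \<subseteq> I \<and> measure M U = \<theta> * measure M I)"

lemma thin:
  assumes "I \<in> T"
  shows "tree_open (thin I)" "thin I \<subseteq> I" "measure M (thin I) = \<theta> * measure M I"
proof -
  have "0 < \<theta> * measure M I" "\<theta> * measure M I < measure M I"
    using \<theta> tree_pos [OF assms] by auto
  then obtain U where "tree_open U \<and> U \<subseteq> I \<and> measure M U = \<theta> * measure M I"
    using tree_open_subset_of_measure [OF assms] by blast
  then have "tree_open (thin I) \<and> thin I \<subseteq> I \<and> measure M (thin I) = \<theta> * measure M I"
    unfolding thin_def by (rule someI)
  then show "tree_open (thin I)" "thin I \<subseteq> I" "measure M (thin I) = \<theta> * measure M I" by auto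
qed

definition refine :: "'a set \<Rightarrow> 'a set" where
  "refine S = \<Union> (thin ` max_sets S)"

lemma tree_open_refine: "tree_open (refine S)"
  unfolding refine_def by (rule tree_open_Union) (use thin max_setsD in auto)

lemma refine_subset: "refine S \<subseteq> S"
  unfolding refine_def using thin max_setsD by blast

text \<open>Since \<open>Z\<close> cuts no maximal set of \<open>S\<close>, both sides are countable
  sums over the maximal sets inside \<open>Z\<close>, and each of these keeps the proportion
  \<open>\<theta>\<close>.\<close>

lemma measure_refine_Int:
  assumes S: "tree_open S" and Z: "\<And>J. J \<in> max_sets S \<Longrightarrow> J \<subseteq> Z \<or> J \<inter> Z = {}"
  shows "measure M (refine S \<inter> Z) = \<theta> * measure M (S \<inter> Z)"
proof -
  define \<J> where "\<J> = {J \<in> max_sets S. J \<subseteq> Z}"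
  have \<J>: "countable \<J>"
    by (rule countable_subset [OF _ countable_max_sets [of S]]) (auto simp: \<J>_def)
  have \<J>T: "J \<in> T" if "J \<in> \<J>" for J using that by (auto simp: \<J>_def max_setsD)
  have disj: "J \<inter> J' = {}" if "J \<in> \<J>" "J' \<in> \<J>" "J \<noteq> J'" for J J'
    using that max_sets_disjoint [of J S J'] by (auto simp: \<J>_def)
  have disj': "thin J \<inter> thin J' = {}" if "J \<in> \<J>" "J' \<in> \<J>" "J \<noteq> J'" for J J'
    using disj [OF that] thin(2) [OF \<J>T] that by blast
  have "S \<inter> Z = (\<Union>J\<in>\<J>. J)"
  proof
    show "S \<inter> Z \<subseteq> (\<Union>J\<in>\<J>. J)"
    proof
      fix x assume x: "x \<in> S \<inter> Z"
      then obtain J where "J \<in> max_sets S" "x \<in> J" using Union_max_sets [OF S] by auto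
      then show "x \<in> (\<Union>J\<in>\<J>. J)" using Z [of J] x by (auto simp: \<J>_def)
    qed
  qed (auto simp: \<J>_def dest: max_setsD)
  then have 1: "emeasure M (S \<inter> Z) = (\<integral>\<^sup>+ J. emeasure M J \<partial>count_space \<J>)"
    using emeasure_UN_countable [of \<J> "\<lambda>J. J" M] \<J> \<J>T disj tree_sets
    by (simp add: disjoint_family_on_def)
  have "refine S \<inter> Z = (\<Union>J\<in>\<J>. thin J)"
  proof
    show "refine S \<inter> Z \<subseteq> (\<Union>J\<in>\<J>. thin J)"
    proof
      fix x assume x: "x \<in> refine S \<inter> Z"
      then obtain J where "J \<in> max_sets S" "x \<in> thin J" by (auto simp: refine_def)
      moreover from this have "x \<in> J" using thin(2) [of J] max_setsD(1) by blast
      ultimately show "x \<in> (\<Union>J\<in>\<J>. thin J)" using Z [of J] x by (auto simp: \<J>_def)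
    qed
    have "thin J \<subseteq> refine S \<inter> Z" if "J \<in> \<J>" for J
      using that thin(2) [OF \<J>T [OF that]] by (auto simp: \<J>_def refine_def)
    then show "(\<Union>J\<in>\<J>. thin J) \<subseteq> refine S \<inter> Z" by blast
  qed
  then have "emeasure M (refine S \<inter> Z) = (\<integral>\<^sup>+ J. emeasure M (thin J) \<partial>count_space \<J>)"
    using emeasure_UN_countable [of \<J> thin M] \<J> tree_open_sets [OF thin(1) [OF \<J>T]] disj'
    by (simp add: disjoint_family_on_def)
  also have "\<dots> = (\<integral>\<^sup>+ J. ennreal \<theta> * emeasure M J \<partial>count_space \<J>)"
    using \<J>T thin(3) \<theta> by (intro nn_integral_cong) (simp add: emeasure_eq_measure ennreal_mult)
  also have "\<dots> = ennreal \<theta> * emeasure M (S \<inter> Z)"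
    unfolding 1 by (rule nn_integral_cmult) simp
  finally show ?thesis
    using \<theta> by (simp add: emeasure_eq_measure ennreal_mult [symmetric])
qed

definition nest :: "nat \<Rightarrow> 'a set" where
  "nest n = (refine ^^ n) (space M)"

lemma nest_simps [simp]: "nest 0 = space M" "nest (Suc n) = refine (nest n)"
  by (simp_all add: nest_def)

lemma tree_open_nest: "tree_open (nest n)"
  by (cases n) (auto simp: tree_open_refine tree_open_tree space_in_tree)

lemma nest_sets [measurable]: "nest n \<in> sets M"
  by (rule tree_open_sets [OF tree_open_nest])

lemma nest_antimono: "m \<le> n \<Longrightarrow> nest n \<subseteq> nest m"
  by (rule lift_Suc_antimono_le) (auto intro: refine_subset [THEN subsetD])

text \<open>A maximal set of a later stage is a tree set inside \<open>nest m\<close>, so it lies in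
  a single maximal set of \<open>nest m\<close>. Thus \<open>I\<close> never cuts it, and every
  stage contributes one factor \<open>\<theta>\<close>.\<close>

lemma measure_nest_Int:
  assumes I: "I \<in> max_sets (nest m)"
  shows "measure M (nest (m + j) \<inter> I) = \<theta> ^ j * measure M I"
proof (induction j)
  case 0
  then show ?case using max_setsD(2) [OF I] by (simp add: Int_absorb1)
next
  case (Suc j)
  have "measure M (refine (nest (m + j)) \<inter> I) = \<theta> * measure M (nest (m + j) \<inter> I)"
  proof (rule measure_refine_Int [OF tree_open_nest])
    fix J assume J: "J \<in> max_sets (nest (m + j))"
    then have "J \<subseteq> nest m" using max_setsD(2) nest_antimono [of m "m + j"] by fastforce
    then obtain J' where J': "J' \<in> max_sets (nest m)" "J \<subseteq> J'"
      using max_sets_superset max_setsD(1) J by blast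
    then show "J \<subseteq> I \<or> J \<inter> I = {}" using max_sets_disjoint [OF J'(1) I] by blast
  qed
  then show ?case using Suc by simp
qed

section \<open>Functions constant on the layers\<close>

definition layer :: "nat \<Rightarrow> 'a set" where
  "layer j = nest j - nest (Suc j)"

lemma layer_sets [measurable]: "layer j \<in> sets M"
  unfolding layer_def by measurable

lemma layer_unique:
  assumes "x \<in> layer i" "x \<in> layer j" shows "i = j"
proof -
  have *: False if "x \<in> layer i" "x \<in> layer j" "i < j" for i j
    using that nest_antimono [of "Suc i" j] by (auto simp: layer_def simp del: nest_simps)
  show ?thesis using * [of i j] * [of j i] assms by (metis linorder_neqE_nat)
qed

lemma measure_layer_Int:
  assumes "I \<in> max_sets (nest m)"
  shows "measure M (layer (m + j) \<inter> I) = (1 - \<theta>) * \<theta> ^ j * measure M I"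
proof -
  have [measurable]: "I \<in> sets M" using assms max_setsD tree_sets by blast
  have "measure M (layer (m + j) \<inter> I) = measure M (nest (m + j) \<inter> I - nest (m + Suc j) \<inter> I)"
    by (rule arg_cong [where f = "measure M"]) (auto simp: layer_def)
  also have "\<dots> = measure M (nest (m + j) \<inter> I) - measure M (nest (m + Suc j) \<inter> I)"
    using nest_antimono [of "m + j" "m + Suc j"]
    by (intro finite_measure_Diff) (auto simp del: nest_simps add_Suc_right)
  also have "\<dots> = (1 - \<theta>) * \<theta> ^ j * measure M I"
    unfolding measure_nest_Int [OF assms] by (simp add: algebra_simps)
  finally show ?thesis .
qed

text \<open>The layers are disjoint, so at most one term is nonzero at each point; on the
  intersection of all \<open>nest j\<close> the value is 0.\<close>

definition step :: "(nat \<Rightarrow> real) \<Rightarrow> 'a \<Rightarrow> real" where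
  "step a x = (\<Sum>j. a j * indicator (layer j) x)"

lemma step_layer: "x \<in> layer j \<Longrightarrow> step a x = a j"
proof -
  assume x: "x \<in> layer j"
  have "a i * indicator (layer i) x = (if i = j then a i else 0)" for i
    using x layer_unique [OF x, of i] by (cases "x \<in> layer i") auto
  then show ?thesis unfolding step_def by (simp add: sums_single [THEN sums_unique, symmetric])
qed

lemma step_outside: "(\<And>j. x \<notin> layer j) \<Longrightarrow> step a x = 0"
  by (simp add: step_def)

lemma step_measurable [measurable]: "step a \<in> borel_measurable M"
  unfolding step_def [abs_def] by measurable

lemma step_nonneg: "(\<And>j. 0 \<le> a j) \<Longrightarrow> 0 \<le> step a x"
  by (cases "\<exists>j. x \<in> layer j") (auto simp: step_layer step_outside)

text \<open>Off the layers this rests on the convention \<open>0 powr p = 0\<close>.\<close>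

lemma step_powr: "step a x powr p = step (\<lambda>j. a j powr p) x"
  by (cases "\<exists>j. x \<in> layer j") (auto simp: step_layer step_outside)

text \<open>A maximal set \<open>I\<close> of \<open>nest m\<close> meets only layers from index
  \<open>m\<close> on, hence the shift in \<open>a (m + j)\<close>. The series is integrated term by
  term, each layer occupying the share \<open>(1 - \<theta>) * \<theta> ^ j\<close> of
  \<open>I\<close>.\<close>

lemma step_integral:
  assumes I: "I \<in> max_sets (nest m)" and a: "\<And>j. 0 \<le> a j"
    and sums: "(\<lambda>j. \<theta> ^ j * a (m + j)) sums s"
  shows "integrable M (\<lambda>x. indicator I x * step a x)"
    "(\<integral>x. indicator I x * step a x \<partial>M) = (1 - \<theta>) * s * measure M I"
proof -
  have [measurable]: "I \<in> sets M" using I max_setsD tree_sets by blast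
  define g where "g j x = a (m + j) * indicator (layer (m + j) \<inter> I) x" for j x
  have g_layer: "(\<lambda>j. g j x) sums (indicator I x * step a x)" for x
  proof (cases "\<exists>j. x \<in> layer j \<inter> I")
    case True
    then obtain i where i: "x \<in> layer i" "x \<in> I" by auto
    then have "x \<in> nest m" "x \<notin> nest (Suc i)" using I max_setsD(2) by (auto simp: layer_def)
    then have "m \<le> i" using nest_antimono [of "Suc i" m] by (metis not_less_eq_eq subsetD)
    have "g j x = (if j = i - m then a (m + j) else 0)" for j
      using i layer_unique [OF i(1), of "m + j"] \<open>m \<le> i\<close>
      by (cases "x \<in> layer (m + j)") (auto simp: g_def)
    moreover have "indicator I x * step a x = a (m + (i - m))"
      using i \<open>m \<le> i\<close> by (simp add: step_layer)
    ultimately show ?thesis using sums_single [of "i - m" "\<lambda>j. a (m + j)"] by simp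
  next
    case False
    then have z: "indicator I x * step a x = 0" by (cases "x \<in> I") (auto simp: step_outside)
    have "g j x = 0" for j using False by (auto simp: g_def indicator_def)
    then show ?thesis unfolding z by simp
  qed
  have int: "integrable M (g j)" for j
    unfolding g_def by (intro integrable_mult_right integrable_real_indicator) (auto simp: emeasure_eq_measure)
  have g0: "0 \<le> g j x" for j x using a by (simp add: g_def)
  have ig: "(\<integral>x. g j x \<partial>M) = (1 - \<theta>) * measure M I * (\<theta> ^ j * a (m + j))" for j
    unfolding g_def using measure_layer_Int [OF I, of j] by simp
  have sm: "(\<lambda>j. \<integral>x. g j x \<partial>M) sums ((1 - \<theta>) * measure M I * s)"
    unfolding ig by (rule sums_mult [OF sums])
  have norm_g: "norm (g j x) = g j x" for j x using g0 by simp
  have eq: "indicator I x * step a x = (\<Sum>j. g j x)" for x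
    using g_layer by (rule sums_unique)
  have *: "AE x in M. summable (\<lambda>j. norm (g j x))" "summable (\<lambda>j. \<integral>x. norm (g j x) \<partial>M)"
    unfolding norm_g using sums_summable [OF g_layer] sums_summable [OF sm] by auto
  show "integrable M (\<lambda>x. indicator I x * step a x)"
    unfolding eq by (rule integrable_suminf [OF int *])
  have "(\<integral>x. indicator I x * step a x \<partial>M) = (\<Sum>j. \<integral>x. g j x \<partial>M)"
    unfolding eq by (rule integral_suminf [OF int *])
  then show "(\<integral>x. indicator I x * step a x \<partial>M) = (1 - \<theta>) * s * measure M I"
    using sums_unique [OF sm] by (simp add: ac_simps)
qed

lemma step_integral_space:
  assumes "\<And>j. 0 \<le> a j" "(\<lambda>j. \<theta> ^ j * a j) sums s"
  shows "integrable M (step a)" "(\<integral>x. step a x \<partial>M) = (1 - \<theta>) * s"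
proof -
  have I: "space M \<in> max_sets (nest 0)" by (simp add: max_sets_space)
  have s: "(\<lambda>j. \<theta> ^ j * a (0 + j)) sums s" using assms by simp
  have "integrable M (\<lambda>x. indicator (space M) x * step a x) \<longleftrightarrow> integrable M (step a)"
    by (intro Bochner_Integration.integrable_cong) auto
  then show "integrable M (step a)" using step_integral(1) [OF I assms(1) s] by simp
  have "(\<integral>x. step a x \<partial>M) = (\<integral>x. indicator (space M) x * step a x \<partial>M)"
    by (intro Bochner_Integration.integral_cong) auto
  then show "(\<integral>x. step a x \<partial>M) = (1 - \<theta>) * s"
    using step_integral(2) [OF I assms(1) s] by (simp add: prob_space)
qed

text \<open>\<open>\<phi>\<close> equals \<open>c f r\<^sup>j\<close> on the \<open>j\<close>-th layer; the relation between \<open>c\<close> and \<open>r\<close> makes its mean over each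
  maximal tree set of \<open>nest m\<close> equal to \<open>f r\<^sup>m\<close>.\<close>

lemma extremal_function:
  fixes p f r c :: real
  assumes p: "p > 1" and f: "f > 0" and r: "r \<ge> 1" "\<theta> * r powr p < 1"
    and c: "c > 0" "c * (1 - \<theta>) = 1 - \<theta> * r"
  obtains \<phi> where "\<phi> \<in> borel_measurable M" "\<forall>x. 0 \<le> \<phi> x" "integrable M (\<lambda>x. \<phi> x powr p)"
    "(\<integral>x. \<phi> x \<partial>M) = f" "(\<integral>x. \<phi> x powr p \<partial>M) = f powr p * c powr p * (1 - \<theta>) / (1 - \<theta> * r powr p)"
    "(\<integral>x. \<phi> x powr p \<partial>M) \<le> c powr p * (\<integral>x. maxop M T \<phi> x powr p \<partial>M)"
proof -
  define a where "a j = c * f * r ^ j" for j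
  define \<phi> where "\<phi> = step a"
  have a0: "0 \<le> a j" for j using c f r by (simp add: a_def)
  have \<phi>0: "0 \<le> \<phi> x" for x unfolding \<phi>_def using a0 by (rule step_nonneg)
  have \<phi>m [measurable]: "\<phi> \<in> borel_measurable M" unfolding \<phi>_def by simp
  \<comment> \<open>Positivity of \<open>c\<close> is what makes the geometric series with quotient
    \<open>\<theta> * r\<close> converge.\<close>
  have "0 < c * (1 - \<theta>)" using c(1) \<theta> by simp
  then have tr: "0 \<le> \<theta> * r" "\<theta> * r < 1" unfolding c(2) using \<theta> r by auto
  have s: "(\<lambda>j. \<theta> ^ j * a (m + j)) sums (c * f * r ^ m * (1 / (1 - \<theta> * r)))" for m
    using sums_mult [OF geometric_sums [of "\<theta> * r"], of "c * f * r ^ m"] tr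
    by (simp add: a_def power_add power_mult_distrib ac_simps)
  have cs: "(1 - \<theta>) * (c * f * r ^ m * (1 / (1 - \<theta> * r))) = f * r ^ m" for m
  proof -
    have "(1 - \<theta>) * (c * f * r ^ m * (1 / (1 - \<theta> * r))) = f * r ^ m * (c * (1 - \<theta>)) / (1 - \<theta> * r)"
      by (simp add: ac_simps)
    then show ?thesis unfolding c(2) using tr by simp
  qed
  have int: "(\<integral>x. \<phi> x \<partial>M) = f"
    using step_integral_space(2) [OF a0, where s = "c * f * r ^ 0 * (1 / (1 - \<theta> * r))"] s [of 0] cs [of 0]
    by (simp add: \<phi>_def)
  have ap: "a j powr p = c powr p * f powr p * (r powr p) ^ j" for j
  proof -
    have "(r ^ j) powr p = (r powr p) ^ j" using r by (induction j) (auto simp: powr_mult)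
    then show ?thesis using c f r by (simp add: a_def powr_mult)
  qed
  have sp: "(\<lambda>j. \<theta> ^ j * a j powr p) sums (c powr p * f powr p * (1 / (1 - \<theta> * r powr p)))"
    using sums_mult [OF geometric_sums [of "\<theta> * r powr p"], of "c powr p * f powr p"] r \<theta>
    by (simp add: ap power_mult_distrib ac_simps)
  have intp: "integrable M (\<lambda>x. \<phi> x powr p)"
    "(\<integral>x. \<phi> x powr p \<partial>M) = f powr p * c powr p * (1 - \<theta>) / (1 - \<theta> * r powr p)"
    unfolding \<phi>_def step_powr using step_integral_space [OF _ sp] by (simp_all add: ac_simps)
  have "AE x in M. \<phi> x powr p \<le> c powr p * maxop M T \<phi> x powr p"
    using maxop_limit [OF p \<phi>m \<phi>0 intp(1)]
  proof eventually_elim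
    case (elim x)
    show ?case
    proof (cases "\<exists>m. x \<in> layer m")
      case True
      \<comment> \<open>On layer \<open>m\<close> the maximal set \<open>I\<close> around
        \<open>x\<close> competes in \<open>maxop\<close> with mean \<open>f * r ^ m\<close>, and
        \<open>\<phi> x\<close> is \<open>c\<close> times that mean.\<close>
      then obtain m where m: "x \<in> layer m" by blast
      then have "x \<in> nest m" by (simp add: layer_def)
      then obtain I where I: "I \<in> max_sets (nest m)" "x \<in> I"
        using Union_max_sets [OF tree_open_nest [of m]] by blast
      have IT: "I \<in> T" using I max_setsD by blast
      have "tree_avg M I \<phi> * measure M I = f * r ^ m * measure M I"
        unfolding tree_avg_times_measure [OF p \<phi>m \<phi>0 intp(1) IT]
        unfolding \<phi>_def step_integral(2) [OF I(1) a0 s] cs ..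
      then have avg: "tree_avg M I \<phi> = f * r ^ m" using tree_pos [OF IT] by simp
      have "ennreal (f * r ^ m) \<le> (SUP I\<in>{I\<in>T. x \<in> I}. ennreal (tree_avg M I \<phi>))"
        using I IT avg by (intro SUP_upper2 [of I]) auto
      \<comment> \<open>Monotonicity of \<open>enn2real\<close> requires a finite supremum, which
        \<open>maxop_limit\<close> supplies almost everywhere.\<close>
      then have "enn2real (ennreal (f * r ^ m)) \<le> maxop M T \<phi> x"
        unfolding maxop_def using elim by (intro enn2real_mono) auto
      then have "c * (f * r ^ m) \<le> c * maxop M T \<phi> x" using f r c by simp
      moreover have "\<phi> x = c * (f * r ^ m)" using m by (simp add: \<phi>_def step_layer a_def)
      ultimately have "\<phi> x \<le> c * maxop M T \<phi> x" by simp
      then have "\<phi> x powr p \<le> (c * maxop M T \<phi> x) powr p"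
        using p \<phi>0 by (intro powr_mono2) auto
      then show ?thesis using c by (simp add: powr_mult maxop_def)
    qed (simp add: \<phi>_def step_outside)
  qed
  then have "(\<integral>x. \<phi> x powr p \<partial>M) \<le> (\<integral>x. c powr p * maxop M T \<phi> x powr p \<partial>M)"
    using intp maxop_powr_integrable [OF p \<phi>m \<phi>0 intp(1)] by (intro integral_mono_AE) auto
  then have "(\<integral>x. \<phi> x powr p \<partial>M) \<le> c powr p * (\<integral>x. maxop M T \<phi> x powr p \<partial>M)" by simp
  then show ?thesis using that \<phi>m \<phi>0 intp int by blast
qed

end

section \<open>Sharpness\<close>

lemma subset_of_measure:
  assumes "0 < k" "k \<le> 1"
  obtains K where "K \<in> sets M" "measure M K = k"
proof (cases "k = 1")
  \<comment> \<open>The greedy choice reaches only values strictly below the total mass, so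
    \<open>k = 1\<close> is handled by the whole space.\<close>
  case True
  then show ?thesis using that [of "space M"] prob_space by simp
next
  case False
  then have "k < measure M (space M)" using assms by (simp add: prob_space)
  from tree_open_subset_of_measure [OF space_in_tree assms(1) this]
  obtain U where "tree_open U" "measure M U = k" .
  then show ?thesis using that tree_open_sets by blast
qed

text \<open>This is the case \<open>\<gamma> = 0\<close>, where both integrals over \<open>K\<close>
  have coefficient 0. The deficit is squeezed between 0, by the inequality itself, and a bound from
  \<open>\<phi> \<le> c * maxop M T \<phi>\<close> almost everywhere.\<close>

lemma maxop_inequality_sharp:
  fixes p f F :: real
  assumes p: "p > 1" and f: "f > 0" and F: "f powr p \<le> F"
  obtains \<beta> :: real and \<phi>s :: "nat \<Rightarrow> 'a \<Rightarrow> real" where "\<beta> \<ge> 0"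
    "\<forall>n. \<phi>s n \<in> borel_measurable M \<and> (\<forall>x. 0 \<le> \<phi>s n x) \<and> integrable M (\<lambda>x. \<phi>s n x powr p) \<and>
       (\<integral>x. \<phi>s n x \<partial>M) = f \<and> (\<integral>x. \<phi>s n x powr p \<partial>M) = F"
    "(\<lambda>n. F - ((p - 1) * \<beta> / (\<beta> + 1) powr p * (\<integral>x. maxop M T (\<phi>s n) x powr p \<partial>M)
        + f powr p / (\<beta> + 1) powr (p - 1))) \<longlonglongrightarrow> 0"
proof -
  define Q where "Q = F / f powr p"
  have Q: "Q \<ge> 1" "F = Q * f powr p" using f F by (auto simp: Q_def field_simps)
  \<comment> \<open>The exponent \<open>Suc n\<close> keeps \<open>\<theta> 0\<close>
    positive.\<close>
  define \<theta> :: "nat \<Rightarrow> real" where "\<theta> n = 1 - (1 / 2) ^ Suc n" for n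
  have \<theta>: "0 < \<theta> n" "\<theta> n < 1" for n using power_less_one_iff [of "1 / 2 :: real" "Suc n"] by (auto simp: \<theta>_def simp del: power_Suc)
  have "\<theta> \<longlonglongrightarrow> 1 - 0"
    unfolding \<theta>_def by (intro tendsto_diff tendsto_const LIMSEQ_Suc LIMSEQ_power_zero) simp
  then have \<theta>_lim: "\<theta> \<longlonglongrightarrow> 1" by simp
  define P where "P n c \<phi> \<longleftrightarrow> 0 < c \<and> c \<le> 1 \<and> c powr p \<le> Q * (1 - p * (1 - c)) \<and>
      Q * (1 - p * (1 - c) / \<theta> n) \<le> c powr p \<and>
      \<phi> \<in> borel_measurable M \<and> (\<forall>x. 0 \<le> \<phi> x) \<and> integrable M (\<lambda>x. \<phi> x powr p) \<and>
      (\<integral>x. \<phi> x \<partial>M) = f \<and> (\<integral>x. \<phi> x powr p \<partial>M) = F \<and> F \<le> c powr p * (\<integral>x. maxop M T \<phi> x powr p \<partial>M)"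
    for n c and \<phi> :: "'a \<Rightarrow> real"
  have "\<exists>c \<phi>. P n c \<phi>" for n
  proof -
    obtain r c where rc: "r \<ge> 1" "\<theta> n * r powr p < 1" "0 < c" "c \<le> 1" "c * (1 - \<theta> n) = 1 - \<theta> n * r"
      "Q * (1 - \<theta> n * r powr p) = c powr p * (1 - \<theta> n)"
      "c powr p \<le> Q * (1 - p * (1 - c))" "Q * (1 - p * (1 - c) / \<theta> n) \<le> c powr p"
      using ratio_exists [OF p \<theta> Q(1)] .
    obtain \<phi> where \<phi>: "\<phi> \<in> borel_measurable M" "\<forall>x. 0 \<le> \<phi> x" "integrable M (\<lambda>x. \<phi> x powr p)"
      "(\<integral>x. \<phi> x \<partial>M) = f" "(\<integral>x. \<phi> x powr p \<partial>M) = f powr p * c powr p * (1 - \<theta> n) / (1 - \<theta> n * r powr p)"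
      "(\<integral>x. \<phi> x powr p \<partial>M) \<le> c powr p * (\<integral>x. maxop M T \<phi> x powr p \<partial>M)"
      using extremal_function [OF \<theta> p f rc(1,2,3,5)] .
    \<comment> \<open>The equation that fixed \<open>r\<close> in \<open>ratio_exists\<close> is
      precisely the condition that the integral of \<open>\<phi> powr p\<close> be
      \<open>F\<close>.\<close>
    have "f powr p * (c powr p * (1 - \<theta> n)) / (1 - \<theta> n * r powr p) = F"
      unfolding rc(6) [symmetric] Q(2) using rc(2) by simp
    then have "(\<integral>x. \<phi> x powr p \<partial>M) = F" using \<phi>(5) by (simp add: mult.assoc)
    then have "P n c \<phi>" using rc(3,4,7,8) \<phi>(1,2,3,4,6) by (simp add: P_def)
    then show ?thesis by blast
  qed
  then obtain c \<phi> where P: "\<And>n. P n (c n) (\<phi> n)" by metis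
  have c: "\<And>n. 0 < c n" "\<And>n. c n \<le> 1" "\<And>n. c n powr p \<le> Q * (1 - p * (1 - c n))"
      "\<And>n. Q * (1 - p * (1 - c n) / \<theta> n) \<le> c n powr p"
    and \<phi>: "\<And>n. \<phi> n \<in> borel_measurable M" "\<And>n x. 0 \<le> \<phi> n x" "\<And>n. integrable M (\<lambda>x. \<phi> n x powr p)"
      "\<And>n. (\<integral>x. \<phi> n x \<partial>M) = f" "\<And>n. (\<integral>x. \<phi> n x powr p \<partial>M) = F"
      "\<And>n. F \<le> c n powr p * (\<integral>x. maxop M T (\<phi> n) x powr p \<partial>M)"
    using P by (simp_all only: P_def)
  have "\<forall>n. c n \<in> {0..1}" using c by (auto simp: less_imp_le)
  then obtain l \<sigma> where l: "l \<in> {0..1}" "strict_mono \<sigma>" "(c \<circ> \<sigma>) \<longlonglongrightarrow> l"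
    by (rule seq_compactE [OF compact_imp_seq_compact [OF compact_Icc]])
  have cl: "(\<lambda>n. c (\<sigma> n)) \<longlonglongrightarrow> l" using l(3) by (simp add: comp_def)
  have cpl: "(\<lambda>n. c (\<sigma> n) powr p) \<longlonglongrightarrow> l powr p"
    using cl p by (intro tendsto_powr') (auto simp: c less_imp_le)
  have \<theta>l: "(\<lambda>n. \<theta> (\<sigma> n)) \<longlonglongrightarrow> 1"
    using LIMSEQ_subseq_LIMSEQ [OF \<theta>_lim l(2)] by (simp add: comp_def)
  \<comment> \<open>Both pinching bounds have the same limit, since \<open>\<theta>\<close> tends to
    1.\<close>
  have "l powr p \<le> Q * (1 - p * (1 - l))"
    by (rule LIMSEQ_le [OF cpl, of "\<lambda>n. Q * (1 - p * (1 - c (\<sigma> n)))"]) (use c cl in \<open>auto intro!: tendsto_intros\<close>)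
  moreover have "(\<lambda>n. Q * (1 - p * (1 - c (\<sigma> n)) / \<theta> (\<sigma> n))) \<longlonglongrightarrow> Q * (1 - p * (1 - l) / 1)"
    by (intro tendsto_intros cl \<theta>l) simp
  then have "Q * (1 - p * (1 - l) / 1) \<le> l powr p"
    by (rule LIMSEQ_le [OF _ cpl]) (use c in auto)
  ultimately have leq: "l powr p = Q * (1 - p * (1 - l))" by simp
  \<comment> \<open>At \<open>l = 0\<close> the equation would read \<open>0 = Q * (1 - p)\<close>,
    whose right side is negative.\<close>
  have "l \<noteq> 0" using leq p Q by auto
  then have l0: "0 < l" using l by simp
  define \<beta> where "\<beta> = 1 / l - 1"
  have b: "\<beta> \<ge> 0" "\<beta> + 1 = 1 / l" using l l0 by (auto simp: \<beta>_def)
  define N where "N n = (\<integral>x. maxop M T (\<phi> (\<sigma> n)) x powr p \<partial>M)" for n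
  define D where "D n = F - ((p - 1) * \<beta> / (\<beta> + 1) powr p * N n + f powr p / (\<beta> + 1) powr (p - 1))" for n
  have Deq: "D n = F - ((p - 1) * \<beta> * l powr p * N n + f powr p * l powr (p - 1))" for n
    unfolding D_def b(2) using l0 by (simp add: powr_divide)
  \<comment> \<open>With \<open>\<gamma> = 0\<close> and \<open>K = space M\<close> the inequality
    says exactly that the deficit is non-negative.\<close>
  have lower: "0 \<le> D n" for n
    using maxop_inequality [OF p \<phi>(1,2,3), of 0 \<beta> "space M" "\<sigma> n"] b \<phi>(4,5) by (simp add: D_def N_def)
  \<comment> \<open>\<open>E n\<close> arises from \<open>D n\<close> by replacing
    \<open>N n\<close> with its lower bound \<open>F / c (\<sigma> n) powr p\<close>.\<close>
  define E where "E n = F - ((p - 1) * \<beta> * l powr p * (F / c (\<sigma> n) powr p) + f powr p * l powr (p - 1))" for n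
  have upper: "D n \<le> E n" for n
  proof -
    have "F / c (\<sigma> n) powr p \<le> N n" using \<phi>(6) [of "\<sigma> n"] c(1) by (simp add: N_def divide_le_eq mult.commute)
    then have "(p - 1) * \<beta> * l powr p * (F / c (\<sigma> n) powr p) \<le> (p - 1) * \<beta> * l powr p * N n"
      using p b by (intro mult_left_mono) auto
    then show ?thesis by (simp add: Deq E_def)
  qed
  have "E \<longlonglongrightarrow> F - ((p - 1) * \<beta> * l powr p * (F / l powr p) + f powr p * l powr (p - 1))"
    unfolding E_def by (intro tendsto_intros cpl) (use l0 in auto)
  also have "F - ((p - 1) * \<beta> * l powr p * (F / l powr p) + f powr p * l powr (p - 1)) = 0"
  proof -
    \<comment> \<open>The equation for \<open>l\<close>, divided by \<open>l\<close> and rewritten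
      with \<open>1 / l = \<beta> + 1\<close>, yields \<open>Q * (1 - (p - 1) * \<beta>)\<close>;
      this is what makes the limit vanish.\<close>
    have "l powr (p - 1) = l powr p / l" using l0 by (simp add: powr_diff)
    also have "\<dots> = Q * (1 - (p - 1) * \<beta>)" unfolding leq using l0 by (simp add: \<beta>_def field_simps)
    finally show ?thesis unfolding Q(2) using l0 by (simp add: right_diff_distrib left_diff_distrib mult.commute)
  qed
  finally have "D \<longlonglongrightarrow> 0"
    by (intro tendsto_sandwich [of "\<lambda>_. 0" D _ E]) (use lower upper in auto)
  then have "(\<lambda>n. F - ((p - 1) * \<beta> / (\<beta> + 1) powr p * (\<integral>x. maxop M T (\<phi> (\<sigma> n)) x powr p \<partial>M)
        + f powr p / (\<beta> + 1) powr (p - 1))) \<longlonglongrightarrow> 0"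
    unfolding D_def N_def .
  then show ?thesis by (rule that [OF b(1), rotated]) (simp add: \<phi>(1-5))
qed

end

theorem theorem1p3:
  fixes M :: "'a measure" and T :: "'a set set" and C :: "'a set \<Rightarrow> 'a set set"
    and p f F :: real
  assumes "prob_space M" and "nonatomic M" and "is_tree M T C"
    and "p > 1" and "0 < f" and "f powr p \<le> F"
  shows "(\<forall>\<beta> \<gamma> K \<phi>. \<beta> \<ge> \<gamma> \<and> \<gamma> \<ge> 0 \<and> K \<in> sets M \<and> 0 < measure M K \<and> measure M K \<le> 1 \<and>
            \<phi> \<in> borel_measurable M \<and> (\<forall>x\<in>space M. 0 \<le> \<phi> x) \<and>
            integrable M (\<lambda>x. \<phi> x powr p) \<and>
            (LINT x|M. \<phi> x) = f \<and> (LINT x|M. \<phi> x powr p) = F \<longrightarrow>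
            F \<ge> (1 - 1 / (1 + \<gamma>) powr (p - 1)) * (LINT x:K|M. \<phi> x powr p)
                 + (p - 1) * \<beta> / (\<beta> + 1) powr p * (LINT x|M. maxop M T \<phi> x powr p)
                 - (p - 1) * \<gamma> / (\<beta> + 1) powr p * (LINT x:K|M. maxop M T \<phi> x powr p)
                 + f powr p / (\<beta> + 1) powr (p - 1))
       \<and> (\<forall>k. 0 < k \<and> k \<le> 1 \<longrightarrow>
            (\<exists>\<beta> \<gamma> (Ks :: nat \<Rightarrow> 'a set) (\<phi>s :: nat \<Rightarrow> 'a \<Rightarrow> real).
               \<beta> \<ge> \<gamma> \<and> \<gamma> \<ge> 0 \<and> (\<forall>n. Ks n \<in> sets M) \<and> (\<lambda>n. measure M (Ks n)) \<longlonglongrightarrow> k \<and>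
               (\<forall>n. \<phi>s n \<in> borel_measurable M \<and> (\<forall>x\<in>space M. 0 \<le> \<phi>s n x) \<and>
                    integrable M (\<lambda>x. \<phi>s n x powr p) \<and>
                    (LINT x|M. \<phi>s n x) = f \<and> (LINT x|M. \<phi>s n x powr p) = F) \<and>
               (\<lambda>n. F - ((1 - 1 / (1 + \<gamma>) powr (p - 1)) * (LINT x:Ks n|M. \<phi>s n x powr p)
                 + (p - 1) * \<beta> / (\<beta> + 1) powr p * (LINT x|M. maxop M T (\<phi>s n) x powr p)
                 - (p - 1) * \<gamma> / (\<beta> + 1) powr p * (LINT x:Ks n|M. maxop M T (\<phi>s n) x powr p)
                 + f powr p / (\<beta> + 1) powr (p - 1))) \<longlonglongrightarrow> 0))"
proof -
  interpret tree_space M T C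
    using assms by (simp add: tree_space_def tree_space_axioms_def)
  have sharp: "\<exists>\<beta> \<gamma> (Ks :: nat \<Rightarrow> 'a set) (\<phi>s :: nat \<Rightarrow> 'a \<Rightarrow> real).
               \<beta> \<ge> \<gamma> \<and> \<gamma> \<ge> 0 \<and> (\<forall>n. Ks n \<in> sets M) \<and> (\<lambda>n. measure M (Ks n)) \<longlonglongrightarrow> k \<and>
               (\<forall>n. \<phi>s n \<in> borel_measurable M \<and> (\<forall>x\<in>space M. 0 \<le> \<phi>s n x) \<and>
                    integrable M (\<lambda>x. \<phi>s n x powr p) \<and>
                    (LINT x|M. \<phi>s n x) = f \<and> (LINT x|M. \<phi>s n x powr p) = F) \<and>
               (\<lambda>n. F - ((1 - 1 / (1 + \<gamma>) powr (p - 1)) * (LINT x:Ks n|M. \<phi>s n x powr p)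
                 + (p - 1) * \<beta> / (\<beta> + 1) powr p * (LINT x|M. maxop M T (\<phi>s n) x powr p)
                 - (p - 1) * \<gamma> / (\<beta> + 1) powr p * (LINT x:Ks n|M. maxop M T (\<phi>s n) x powr p)
                 + f powr p / (\<beta> + 1) powr (p - 1))) \<longlonglongrightarrow> 0"
    if k: "0 < k" "k \<le> 1" for k
  proof -
    obtain K where K: "K \<in> sets M" "measure M K = k" using subset_of_measure [OF k] .
    obtain \<beta> :: real and \<phi>s :: "nat \<Rightarrow> 'a \<Rightarrow> real" where "\<beta> \<ge> 0"
      "\<forall>n. \<phi>s n \<in> borel_measurable M \<and> (\<forall>x. 0 \<le> \<phi>s n x) \<and> integrable M (\<lambda>x. \<phi>s n x powr p) \<and>
         (\<integral>x. \<phi>s n x \<partial>M) = f \<and> (\<integral>x. \<phi>s n x powr p \<partial>M) = F"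
      "(\<lambda>n. F - ((p - 1) * \<beta> / (\<beta> + 1) powr p * (\<integral>x. maxop M T (\<phi>s n) x powr p \<partial>M)
        + f powr p / (\<beta> + 1) powr (p - 1))) \<longlonglongrightarrow> 0"
      using maxop_inequality_sharp [OF assms(4,5,6)] .
    then show ?thesis
      \<comment> \<open>With \<open>\<gamma> = 0\<close> the factors of both integrals over
        \<open>K\<close> vanish, so a constant sequence of sets of measure \<open>k\<close>
        suffices.\<close>
      using K by (intro exI [of _ \<beta>] exI [of _ 0] exI [of _ "\<lambda>_. K"] exI [of _ \<phi>s]) simp
  qed
  show ?thesis
  proof (intro conjI allI impI; (elim conjE)?)
    fix \<beta> \<gamma> :: real and K and \<phi> :: "'a \<Rightarrow> real"
    assume *: "\<gamma> \<le> \<beta>" "0 \<le> \<gamma>" "K \<in> sets M" "\<phi> \<in> borel_measurable M" "\<forall>x\<in>space M. 0 \<le> \<phi> x"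
      "integrable M (\<lambda>x. \<phi> x powr p)" "(LINT x|M. \<phi> x) = f" "(LINT x|M. \<phi> x powr p) = F"
    then have nn: "0 \<le> \<phi> x" if "x \<in> space M" for x using that by blast
    show "F \<ge> (1 - 1 / (1 + \<gamma>) powr (p - 1)) * (LINT x:K|M. \<phi> x powr p)
                 + (p - 1) * \<beta> / (\<beta> + 1) powr p * (LINT x|M. maxop M T \<phi> x powr p)
                 - (p - 1) * \<gamma> / (\<beta> + 1) powr p * (LINT x:K|M. maxop M T \<phi> x powr p)
                 + f powr p / (\<beta> + 1) powr (p - 1)"
      using maxop_inequality [OF assms(4) *(4) nn *(6,1,2,3)] unfolding *(7,8) .
  qed (rule sharp)
qed

end
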